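(* Let $X\subset\mathbb{R}^{n+k}$ be a connected closed set with Hausdorff dimension $n$. Then $X$ is an $n$-dimensional affine linear subspace if and only if we have the following: (1) $X$ satisfies the monotonicity formula at some $p\in X$; (2) there are compact sets $K\subset\mathbb{R}^n$ and $\tilde K\subset\mathbb{R}^{n+k}$ such that $X\setminus\tilde K$ is the graph of a $C^1$-smooth function $u\colon\mathbb{R}^n\setminus K\to\mathbb{R}^k$ with bounded derivative; (3) $\mathcal{N}(X,\infty)$ is a linear subspace.
   Context: Notation: $\mathcal{H}^n$ is the $n$-dimensional Hausdorff measure, $\mu_n$ is the volume of the $n$-dimensional Euclidean unit ball, and $B_r^{m}(p)\subset\mathbb{R}^m$ is the open Euclidean ball of radius $r>0$ centered at $p$. Monotonicity formula: let $X\subset\mathbb{R}^{n+k}$ have Hausdorff dimension $n$ and let $p\in X$. We say that $X$ satisfies the monotonicity formula at $p$ if the function $\theta^n(X,p,\cdot)\colon(0,+\infty)\to[1,+\infty)$ given by $\theta^n(X,p,r)=\frac{\mathcal{H}^n(X\cap B_r^{n+k}(p))}{\mu_n r^n}$ is well-defined (in particular it takes finite values, all $\geq 1$) and nondecreasing, and satisfies: (i) $X$ is $C^1$-smooth at $p$ (i.e. $X\cap U$ is a $C^1$ submanifold of $\mathbb{R}^{n+k}$ for some open neighborhood $U$ of $p$) if and only if $\theta^n(X,p):=\lim_{r\to0^+}\theta^n(X,p,r)=1$; (ii) $\theta^n(X,p,\cdot)$ is a constant function if and only if $X$ is a cone with vertex at $p$. ${\rm Sing}_1(X)$ is the set of points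 $x\in X$ such that $X\cap U$ is not a $C^1$ submanifold of $\mathbb{R}^{n+k}$ for any open neighborhood $U\subset\mathbb{R}^{n+k}$ of $x$. $\mathcal{N}(X,\infty)\subset\mathbb{R}^{n+k}$ is the union of all linear subspaces $T$ for which there is a sequence $\{x_j\}_j\subset X\setminus{\rm Sing}_1(X)$ with $\lim\|x_j\|=+\infty$ and such that the tangent spaces $T_{x_j}X$ converge to $T$.
   Formalization: In (2) the graph is taken in some orthonormal coordinates of R^{n+k}, since in fixed coordinates a vertical plane is affine but no graph; n ≥ 1 is assumed (for a point N(X,∞) is empty), and k ≥ 1. *)

theory Defs
  imports "HOL-Analysis.Analysis"
begin

text \<open>The \<open>s\<close>-dimensional Hausdorff measure is the supremum over \<open>\<delta> > 0\<close> of the infima of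
  \<open>\<Sum>i. unit_ball_vol s * (diam (C i) / 2) ^ s\<close> over countable covers by sets of diameter at
  most \<open>\<delta>\<close>. With this constant it is Lebesgue measure on \<open>n\<close>-dimensional Euclidean space when
  \<open>s = n\<close>. The case \<open>s = 0\<close> is separate because \<open>0 powr 0 = 0\<close>, while a nonempty set
  must get weight \<open>1\<close>. Boundedness of the covering sets is required explicitly because
  \<open>diameter\<close> is unspecified on unbounded sets.\<close>

definition hausdorff_weight :: "real \<Rightarrow> 'a::metric_space set \<Rightarrow> ennreal" where
  "hausdorff_weight s C =
    (if C = {} then 0 else if s = 0 then 1
     else ennreal (unit_ball_vol s * (diameter C / 2) powr s))"

definition hausdorff_premeasure :: "real \<Rightarrow> real \<Rightarrow> 'a::metric_space set \<Rightarrow> ennreal" where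
  "hausdorff_premeasure \<delta> s A =
    (INF C \<in> {C :: nat \<Rightarrow> 'a set.
        A \<subseteq> (\<Union>i. C i) \<and> (\<forall>i. bounded (C i) \<and> diameter (C i) \<le> \<delta>)}.
      \<Sum>i. hausdorff_weight s (C i))"

definition hausdorff_measure :: "real \<Rightarrow> 'a::metric_space set \<Rightarrow> ennreal" where
  "hausdorff_measure s A = (SUP \<delta>\<in>{0<..}. hausdorff_premeasure \<delta> s A)"

definition hausdorff_dim :: "'a::metric_space set \<Rightarrow> ennreal" where
  "hausdorff_dim A = Inf {ennreal s |s. 0 \<le> s \<and> hausdorff_measure s A = 0}"


definition has_C1_derivative_on ::
    "('a::real_normed_vector \<Rightarrow> 'b::real_normed_vector) \<Rightarrow> ('a \<Rightarrow> 'a \<Rightarrow>\<^sub>L 'b) \<Rightarrow> 'a set \<Rightarrow> bool" where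
  "has_C1_derivative_on f f' U \<longleftrightarrow>
    open U \<and> (\<forall>x\<in>U. (f has_derivative blinfun_apply (f' x)) (at x)) \<and> continuous_on U f'"

definition C1_on :: "('a::real_normed_vector \<Rightarrow> 'b::real_normed_vector) \<Rightarrow> 'a set \<Rightarrow> bool" where
  "C1_on f U \<longleftrightarrow> (\<exists>f'. has_C1_derivative_on f f' U)"

definition C1_submanifold :: "nat \<Rightarrow> 'a::euclidean_space set \<Rightarrow> bool" where
  "C1_submanifold d S \<longleftrightarrow>
    (\<forall>x\<in>S. \<exists>U V \<phi> \<psi> L. x \<in> U \<and> homeomorphism U V \<phi> \<psi> \<and> C1_on \<phi> U \<and> C1_on \<psi> V
       \<and> subspace (L :: 'a set) \<and> dim L = d \<and> \<phi> ` (S \<inter> U) = L \<inter> V)"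

definition C1_smooth_at :: "'a::euclidean_space set \<Rightarrow> 'a \<Rightarrow> bool" where
  "C1_smooth_at X p \<longleftrightarrow> (\<exists>U d. open U \<and> p \<in> U \<and> C1_submanifold d (X \<inter> U))"

definition Sing1 :: "'a::euclidean_space set \<Rightarrow> 'a set" where
  "Sing1 X = {x \<in> X. \<not> C1_smooth_at X x}"

text \<open>Velocities at \<open>x\<close> of \<open>C\<^sup>1\<close> curves in \<open>X\<close>; only used at points where \<open>X\<close> is
  \<open>C\<^sup>1\<close>-smooth.\<close>

definition tangent_space :: "'a::euclidean_space set \<Rightarrow> 'a \<Rightarrow> 'a set" where
  "tangent_space X x =
    {v. \<exists>\<gamma> \<epsilon>. \<epsilon> > 0 \<and> \<gamma> C1_differentiable_on {-\<epsilon><..<\<epsilon>} \<and> \<gamma> ` {-\<epsilon><..<\<epsilon>} \<subseteq> X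
        \<and> \<gamma> 0 = x \<and> (\<gamma> has_vector_derivative v) (at (0::real))}"

text \<open>Convergence in the Grassmannian: the operator norm of the difference of the orthogonal
  projections tends to \<open>0\<close>. The orthogonal projection onto a subspace is \<open>closest_point\<close>.\<close>

definition subspaces_tendsto :: "(nat \<Rightarrow> 'a::euclidean_space set) \<Rightarrow> 'a set \<Rightarrow> bool" where
  "subspaces_tendsto T L \<longleftrightarrow>
    (\<lambda>j. onorm (\<lambda>v. closest_point (T j) v - closest_point L v)) \<longlonglongrightarrow> 0"

definition tangents_at_infinity :: "'a::euclidean_space set \<Rightarrow> 'a set" where
  "tangents_at_infinity X =
    \<Union>{T. subspace T \<and>
        (\<exists>x. (\<forall>j. x j \<in> X - Sing1 X) \<and> filterlim (\<lambda>j. norm (x j)) at_top sequentially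
           \<and> subspaces_tendsto (\<lambda>j. tangent_space X (x j)) T)}"


definition density_ratio :: "nat \<Rightarrow> 'a::euclidean_space set \<Rightarrow> 'a \<Rightarrow> real \<Rightarrow> ennreal" where
  "density_ratio n X p r =
    hausdorff_measure (real n) (X \<inter> ball p r) / ennreal (unit_ball_vol (real n) * r ^ n)"

definition cone_with_vertex :: "'a::real_vector \<Rightarrow> 'a set \<Rightarrow> bool" where
  "cone_with_vertex p X \<longleftrightarrow> cone ((\<lambda>x. x - p) ` X)"

definition satisfies_monotonicity_formula :: "nat \<Rightarrow> 'a::euclidean_space set \<Rightarrow> 'a \<Rightarrow> bool" where
  "satisfies_monotonicity_formula n X p \<longleftrightarrow>
     p \<in> X
   \<and> (\<forall>r>0. 1 \<le> density_ratio n X p r \<and> density_ratio n X p r < \<infinity>)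
   \<and> mono_on {0<..} (density_ratio n X p)
   \<and> (C1_smooth_at X p \<longleftrightarrow> (density_ratio n X p \<longlongrightarrow> 1) (at_right 0))
   \<and> (density_ratio n X p constant_on {0<..} \<longleftrightarrow> cone_with_vertex p X)"


text \<open>The graph is taken in suitable orthonormal coordinates, given by \<open>A\<close>: in fixed
  coordinates no vertical plane would be a graph.\<close>

definition C1_graph_outside_compact ::
    "((real^'n::finite) \<times> (real^'k::finite)) set \<Rightarrow> bool" where
  "C1_graph_outside_compact X \<longleftrightarrow>
    (\<exists>A K K' (u :: real^'n \<Rightarrow> real^'k) u'.
       orthogonal_transformation A \<and> compact K \<and> compact K'
     \<and> has_C1_derivative_on u u' (- K) \<and> bounded (u' ` (- K))
     \<and> A ` (X - K') = {(x, u x) |x. x \<in> - K})"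

end

theory Submission
  imports Defs
begin

text \<open>If \<open>X\<close> is an affine \<open>n\<close>-plane, everything reduces to the fact that \<open>n\<close>-dimensional Hausdorff
  measure of an isometrically embedded ball is its Lebesgue measure: the upper bound is Vitali's
  covering theorem, the lower bound the isodiametric inequality, which follows from the
  Prekopa--Leindler inequality applied to the indicators of \<open>A\<close>, \<open>-A\<close> and \<open>(A - A)/2\<close>.

  Conversely, all limits of tangent planes at infinity are graphs over \<open>\<real>\<^sup>n\<close> with a uniformly bounded
  slope, so their union contains no vertical vector. If it is a linear subspace, two different
  limits would produce a vertical difference; hence \<open>Du\<close> converges at infinity to a single
  \<open>\<Lambda>\<close>. Outside a large ball \<open>X\<close> is then a \<open>(1 + e)\<close>-Lipschitz image of a part of the plane
  \<open>graph \<Lambda>\<close>, so the limit of the density ratio as \<open>r \<longlongrightarrow> \<infinity>\<close> is at most \<open>1\<close>. By monotonicity the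
  ratio is constantly \<open>1\<close>, so \<open>X\<close> is a cone with vertex \<open>p\<close>, and a closed cone asymptotic to
  \<open>graph \<Lambda>\<close> is \<open>p + graph \<Lambda>\<close>.\<close>

section \<open>Hausdorff measure of locally Lipschitz images\<close>

text \<open>The ratio is compared with exactly \<open>1\<close>, so no estimate of Hausdorff measure
  may lose a dimensional factor. Hence the upper bound uses disjoint balls that exhaust the set up
  to measure zero, and the lower bound needs the isodiametric inequality, because a cover consists
  of arbitrary sets of which only the diameter is known. Wasteful covers suffice for null sets.

  The region outside a large ball is not convex, so a small derivative of
  \<open>u - \<Lambda>\<close> gives a small Lipschitz constant only on convex pieces. The measure
  bound therefore asks for the Lipschitz condition just on balls contained in the domain, and the
  size of \<open>u - \<Lambda>\<close> is estimated along radial segments, at the price of an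
  additive constant. That constant and the measure of the bounded part of \<open>X\<close> both
  disappear after division by \<open>r ^ n\<close>. The shape of \<open>X\<close> near
  \<open>K'\<close> is uncontrolled; finiteness of the ratio at one radius bounds its measure there.

  In the converse direction only upper bounds for the measure of \<open>X\<close> have to be proved:
  that the ratio is at least \<open>1\<close> is part of the monotonicity formula.\<close>

lemma hausdorff_premeasure_le_cover:
  fixes A :: "'a::metric_space set"
  assumes "countable I" "A \<subseteq> (\<Union>i\<in>I. C i)" "0 \<le> \<delta>"
    and "\<And>i. i \<in> I \<Longrightarrow> bounded (C i) \<and> diameter (C i) \<le> \<delta>"
  shows "hausdorff_premeasure \<delta> s A \<le> (\<integral>\<^sup>+i. hausdorff_weight s (C i) \<partial>count_space I)"
proof -
  let ?N = "to_nat_on I ` I"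
  \<comment> \<open>Positions that enumerate no element of \<open>I\<close> receive the empty set,
    which has weight 0; finite and empty \<open>I\<close> need no separate treatment.\<close>
  define D where "D m = (if m \<in> ?N then C (from_nat_into I m) else {})" for m
  have bij: "bij_betw (to_nat_on I) I ?N"
    using assms(1) by (simp add: inj_on_imp_bij_betw inj_on_to_nat_on)
  have D: "D (to_nat_on I i) = C i" if "i \<in> I" for i
    using that assms(1) by (simp add: D_def)
  have "hausdorff_premeasure \<delta> s A \<le> (\<Sum>m. hausdorff_weight s (D m))"
    unfolding hausdorff_premeasure_def
  proof (rule INF_lower, intro CollectI conjI allI)
    show "A \<subseteq> (\<Union>m. D m)"
      using assms(2) D by fastforce
    fix m
    show "bounded (D m)" "diameter (D m) \<le> \<delta>"
      using assms(1,3,4) by (auto simp: D_def)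
  qed
  also have "\<dots> = (\<integral>\<^sup>+m. hausdorff_weight s (D m) \<partial>count_space UNIV)"
    by (simp add: nn_integral_count_space_nat)
  also have "\<dots> = (\<integral>\<^sup>+m. hausdorff_weight s (D m) \<partial>count_space ?N)"
    by (rule nn_integral_count_space_eq) (auto simp: D_def hausdorff_weight_def)
  also have "\<dots> = (\<integral>\<^sup>+i. hausdorff_weight s (D (to_nat_on I i)) \<partial>count_space I)"
    by (rule nn_integral_bij_count_space[OF bij, symmetric])
  also have "\<dots> = (\<integral>\<^sup>+i. hausdorff_weight s (C i) \<partial>count_space I)"
    by (rule nn_integral_cong) (simp add: D)
  finally show ?thesis .
qed

lemma hausdorff_premeasure_Un_le:
  fixes A B :: "'a::metric_space set"
  assumes "0 \<le> \<delta>"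
  shows "hausdorff_premeasure \<delta> s (A \<union> B) \<le> hausdorff_premeasure \<delta> s A + hausdorff_premeasure \<delta> s B"
proof -
  let ?cov = "\<lambda>A. {C :: nat \<Rightarrow> 'a set. A \<subseteq> (\<Union>i. C i) \<and> (\<forall>i. bounded (C i) \<and> diameter (C i) \<le> \<delta>)}"
  let ?w = "\<lambda>C. \<Sum>i. hausdorff_weight s (C i)"
  have sum_le: "hausdorff_premeasure \<delta> s (A \<union> B) \<le> ?w C + ?w D" if C: "C \<in> ?cov A" and D: "D \<in> ?cov B" for C D
  proof -
    \<comment> \<open>The sum type \<open>nat + nat\<close> is a countable index set, so the two
      covers are joined without interleaving them.\<close>
    let ?E = "case_sum C D"
    have inl: "bij_betw (Inl :: nat \<Rightarrow> nat + nat) UNIV (range Inl)"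
      and inr: "bij_betw (Inr :: nat \<Rightarrow> nat + nat) UNIV (range Inr)"
      by (simp_all add: inj_on_imp_bij_betw)
    have "hausdorff_premeasure \<delta> s (A \<union> B) \<le> (\<integral>\<^sup>+i. hausdorff_weight s (?E i) \<partial>count_space UNIV)"
    proof (rule hausdorff_premeasure_le_cover)
      show "A \<union> B \<subseteq> (\<Union>i. ?E i)"
      proof
        fix x assume "x \<in> A \<union> B"
        then consider i where "x \<in> ?E (Inl i)" | i where "x \<in> ?E (Inr i)"
          using C D by auto
        then show "x \<in> (\<Union>i. ?E i)"
          by cases blast+
      qed
      show "bounded (?E i) \<and> diameter (?E i) \<le> \<delta>" for i
        using C D by (cases i) auto
    qed (use assms in auto)
    also have "\<dots> = (\<integral>\<^sup>+i. hausdorff_weight s (?E i) * indicator (range Inl) i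
        + hausdorff_weight s (?E i) * indicator (range Inr) i \<partial>count_space UNIV)"
    proof (rule nn_integral_cong)
      show "hausdorff_weight s (?E i) = hausdorff_weight s (?E i) * indicator (range Inl) i
        + hausdorff_weight s (?E i) * indicator (range Inr) i" for i
        by (cases i) (auto simp: indicator_def)
    qed
    also have "\<dots> = (\<integral>\<^sup>+i. hausdorff_weight s (?E i) \<partial>count_space (range Inl))
        + (\<integral>\<^sup>+i. hausdorff_weight s (?E i) \<partial>count_space (range Inr))"
      by (simp add: nn_integral_add nn_integral_count_space_indicator)
    also have "\<dots> = ?w C + ?w D"
      by (simp flip: nn_integral_bij_count_space[OF inl] nn_integral_bij_count_space[OF inr]
          nn_integral_count_space_nat)
    finally show ?thesis .
  qed
  show ?thesis
  proof (cases "hausdorff_premeasure \<delta> s A + hausdorff_premeasure \<delta> s B = top")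
    case False
    then have fin: "hausdorff_premeasure \<delta> s A < top" "hausdorff_premeasure \<delta> s B < top"
      by (auto simp: less_top)
    show ?thesis
    proof (rule ennreal_le_epsilon)
      fix e :: real assume "0 < e"
      \<comment> \<open>Finiteness is needed for the strict inequality between the infimum and the
        infimum plus \<open>e/2\<close>, which produces a nearly optimal cover.\<close>
      have *: "\<exists>C\<in>?cov S. ?w C < hausdorff_premeasure \<delta> s S + ennreal (e/2)"
        if "hausdorff_premeasure \<delta> s S < top" for S
        unfolding INF_less_iff[symmetric] hausdorff_premeasure_def[symmetric]
        using that \<open>0 < e\<close> by (cases "hausdorff_premeasure \<delta> s S") (auto simp: ennreal_less_iff simp flip: ennreal_plus)
      obtain C D where CD: "C \<in> ?cov A" "?w C < hausdorff_premeasure \<delta> s A + ennreal (e/2)"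
          "D \<in> ?cov B" "?w D < hausdorff_premeasure \<delta> s B + ennreal (e/2)"
        using *[OF fin(1)] *[OF fin(2)] by blast
      have "hausdorff_premeasure \<delta> s (A \<union> B) \<le> ?w C + ?w D"
        using sum_le CD by blast
      also have "\<dots> \<le> (hausdorff_premeasure \<delta> s A + ennreal (e/2)) + (hausdorff_premeasure \<delta> s B + ennreal (e/2))"
        using CD by (intro add_mono) auto
      also have "\<dots> = hausdorff_premeasure \<delta> s A + hausdorff_premeasure \<delta> s B + (ennreal (e/2) + ennreal (e/2))"
        by (simp add: ac_simps)
      also have "ennreal (e/2) + ennreal (e/2) = ennreal e"
        using \<open>0 < e\<close> by (simp flip: ennreal_plus)
      finally show "hausdorff_premeasure \<delta> s (A \<union> B) \<le> hausdorff_premeasure \<delta> s A + hausdorff_premeasure \<delta> s B + ennreal e" .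
    qed
  qed (auto simp: top_unique)
qed

lemma hausdorff_measure_Un_le:
  "hausdorff_measure s (A \<union> B) \<le> hausdorff_measure s A + hausdorff_measure s B"
  unfolding hausdorff_measure_def[of s "A \<union> B"]
proof (rule SUP_least)
  fix \<delta> :: real assume \<delta>: "\<delta> \<in> {0<..}"
  have "hausdorff_premeasure \<delta> s (A \<union> B) \<le> hausdorff_premeasure \<delta> s A + hausdorff_premeasure \<delta> s B"
    using \<delta> by (intro hausdorff_premeasure_Un_le) auto
  also have "\<dots> \<le> hausdorff_measure s A + hausdorff_measure s B"
    unfolding hausdorff_measure_def using \<delta> by (intro add_mono SUP_upper)
  finally show "hausdorff_premeasure \<delta> s (A \<union> B) \<le> hausdorff_measure s A + hausdorff_measure s B" .
qed

lemma hausdorff_measure_mono: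
  assumes "A \<subseteq> B" shows "hausdorff_measure s A \<le> hausdorff_measure s B"
  unfolding hausdorff_measure_def hausdorff_premeasure_def
  by (rule SUP_mono', rule INF_superset_mono) (use assms in auto)

text \<open>The weight of a set is the volume of a ball with the same diameter. The image has
  diameter at most \<open>2 * c * r\<close>, so its weight is at most the volume of a ball of radius
  \<open>c * r\<close>, and no factor beyond \<open>c ^ DIM('a)\<close> is lost.\<close>

lemma hausdorff_weight_Lipschitz_cball:
  fixes f :: "'a::euclidean_space \<Rightarrow> 'b::euclidean_space"
  assumes "c-lipschitz_on (cball x r) f" "0 < r"
  shows "bounded (f ` cball x r)" "diameter (f ` cball x r) \<le> 2 * c * r"
    "hausdorff_weight (real DIM('a)) (f ` cball x r) \<le> ennreal (c ^ DIM('a)) * emeasure lborel (cball x r)"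
proof -
  have c: "0 \<le> c" using assms(1) by (rule lipschitz_on_nonneg)
  have d: "dist (f y) (f z) \<le> 2 * c * r" if "y \<in> cball x r" "z \<in> cball x r" for y z
  proof -
    have "dist y z \<le> dist y x + dist x z" by (rule dist_triangle)
    also have "\<dots> \<le> 2 * r" using that by (simp add: dist_commute)
    finally have "c * dist y z \<le> c * (2 * r)" using c by (rule mult_left_mono)
    with lipschitz_onD[OF assms(1) that] show ?thesis by simp
  qed
  show "bounded (f ` cball x r)"
    by (rule bounded_subset[of "cball (f x) (2 * c * r)"]) (use d assms(2) in auto)
  show diam: "diameter (f ` cball x r) \<le> 2 * c * r"
    by (rule diameter_le) (use d c assms(2) in \<open>auto simp: dist_norm\<close>)
  have "0 \<le> diameter (f ` cball x r)"
    using \<open>bounded (f ` cball x r)\<close> by (rule diameter_ge_0)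
  have "(diameter (f ` cball x r) / 2) ^ DIM('a) \<le> (c * r) ^ DIM('a)"
    using diam \<open>0 \<le> diameter _\<close> by (intro power_mono) auto
  \<comment> \<open>\<open>powr\<close> and the natural power also agree at diameter 0, which occurs
    for constant \<open>f\<close>: both are 0 since the dimension is positive.\<close>
  moreover have "(diameter (f ` cball x r) / 2) powr real DIM('a) = (diameter (f ` cball x r) / 2) ^ DIM('a)"
    using \<open>0 \<le> diameter _\<close> by (cases "diameter (f ` cball x r) = 0") (auto simp: powr_realpow)
  ultimately show "hausdorff_weight (real DIM('a)) (f ` cball x r) \<le> ennreal (c ^ DIM('a)) * emeasure lborel (cball x r)"
    using assms(2) c
    by (auto simp: hausdorff_weight_def emeasure_cball power_mult_distrib simp flip: ennreal_mult
        intro!: ennreal_leI)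
qed

lemma hausdorff_premeasure_Lipschitz_balls:
  fixes f :: "'a::euclidean_space \<Rightarrow> 'b::euclidean_space" and a :: "'i \<Rightarrow> 'a"
  assumes I: "countable I" and r: "\<And>i. i \<in> I \<Longrightarrow> 0 < r i \<and> 2 * c * r i \<le> \<delta>"
    and lip: "\<And>i. i \<in> I \<Longrightarrow> c-lipschitz_on (cball (a i) (r i)) f"
    and "0 \<le> \<delta>" "A \<subseteq> (\<Union>i\<in>I. f ` cball (a i) (r i))"
  shows "hausdorff_premeasure \<delta> (real DIM('a)) A \<le>
    ennreal (c ^ DIM('a)) * (\<integral>\<^sup>+i. emeasure lborel (cball (a i) (r i)) \<partial>count_space I)"
proof -
  have "hausdorff_premeasure \<delta> (real DIM('a)) A \<le>
      (\<integral>\<^sup>+i. hausdorff_weight (real DIM('a)) (f ` cball (a i) (r i)) \<partial>count_space I)"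
  proof (rule hausdorff_premeasure_le_cover)
    show "bounded (f ` cball (a i) (r i)) \<and> diameter (f ` cball (a i) (r i)) \<le> \<delta>" if "i \<in> I" for i
      using hausdorff_weight_Lipschitz_cball(1,2)[OF lip[OF that]] r[OF that] by auto
  qed (use assms in auto)
  also have "\<dots> \<le> (\<integral>\<^sup>+i. ennreal (c ^ DIM('a)) * emeasure lborel (cball (a i) (r i)) \<partial>count_space I)"
    by (intro nn_integral_mono hausdorff_weight_Lipschitz_cball(3)) (use r lip in auto)
  finally show ?thesis by (simp add: nn_integral_cmult)
qed

lemma emeasure_disjoint_cballs_le:
  fixes a :: "'i \<Rightarrow> 'a::euclidean_space"
  assumes "countable I" "pairwise (\<lambda>i j. disjnt (cball (a i) (r i)) (cball (a j) (r j))) I"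
    and "\<And>i. i \<in> I \<Longrightarrow> cball (a i) (r i) \<subseteq> U" "U \<in> sets lborel"
  shows "(\<integral>\<^sup>+i. emeasure lborel (cball (a i) (r i)) \<partial>count_space I) \<le> emeasure lborel U"
proof -
  have "(\<integral>\<^sup>+i. emeasure lborel (cball (a i) (r i)) \<partial>count_space I)
      = emeasure lborel (\<Union>i\<in>I. cball (a i) (r i))"
    using assms(1,2)
    by (intro emeasure_UN_countable[symmetric])
      (auto simp: disjoint_family_on_def pairwise_def disjnt_def)
  also have "\<dots> \<le> emeasure lborel U"
    using assms(3,4) by (intro emeasure_mono) auto
  finally show ?thesis .
qed

text \<open>Vitali's covering lemma inside an open \<open>T \<supseteq> N\<close> of small measure: disjoint balls in \<open>T\<close>
  whose dilations by the factor \<open>5\<close> cover \<open>N\<close> and stay in \<open>\<Omega>\<close>.\<close>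

lemma hausdorff_premeasure_image_null:
  fixes f :: "'a::euclidean_space \<Rightarrow> 'b::euclidean_space"
  assumes "open \<Omega>" and lip: "\<And>x r. cball x r \<subseteq> \<Omega> \<Longrightarrow> c-lipschitz_on (cball x r) f"
    and c: "0 \<le> c" and "0 < \<delta>" and N: "negligible N" "N \<subseteq> \<Omega>"
  shows "hausdorff_premeasure \<delta> (real DIM('a)) (f ` N) = 0"
proof -
  have small: "hausdorff_premeasure \<delta> (real DIM('a)) (f ` N) \<le> 0 + ennreal e" if "0 < e" for e
  proof -
    let ?n = "DIM('a)"
    \<comment> \<open>The final estimate loses the factor \<open>(5 * c) ^ ?n\<close>; adding 1
      keeps the denominator positive when \<open>c = 0\<close>.\<close>
    define e' where "e' = e / ((5 * c) ^ ?n + 1)"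
    have e': "0 < e'" using \<open>0 < e\<close> c by (auto simp: e'_def intro!: divide_pos_pos add_nonneg_pos)
    obtain T where T: "open T" "N \<subseteq> T" "emeasure lebesgue (T - N) < ennreal e'"
      using sets_lebesgue_outer_open[OF _ e'] N(1) by (metis negligible_imp_sets)
    have "emeasure lebesgue T = emeasure lebesgue (T - N)"
      using N(1) T by (intro emeasure_Diff_null_set[symmetric]) (auto simp: negligible_iff_null_sets)
    with T have eT: "emeasure lborel T < ennreal e'" by simp
    \<comment> \<open>The conditions refer to the dilated balls of radius \<open>5 * r\<close>:
      their images must have diameter at most \<delta>, and they must stay where \<open>f\<close> is
      Lipschitz. The bound \<open>r \<le> 1\<close> is there because Vitali's covering lemma
      requires bounded radii.\<close>
    define \<rho> where "\<rho> x = (SOME r. 0 < r \<and> 10 * c * r \<le> \<delta> \<and> r \<le> 1 \<and> cball x (5 * r) \<subseteq> \<Omega> \<inter> T)" for x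
    have \<rho>: "0 < \<rho> x \<and> 10 * c * \<rho> x \<le> \<delta> \<and> \<rho> x \<le> 1 \<and> cball x (5 * \<rho> x) \<subseteq> \<Omega> \<inter> T" if x: "x \<in> N" for x
      unfolding \<rho>_def
    proof (rule someI_ex)
      obtain s where s: "0 < s" "cball x s \<subseteq> \<Omega> \<inter> T"
        using x N T \<open>open \<Omega>\<close> open_contains_cball[of "\<Omega> \<inter> T"] by blast
      let ?r = "min (s/5) (min 1 (\<delta> / (10 * (c + 1))))"
      have "10 * c * ?r \<le> 10 * (c + 1) * (\<delta> / (10 * (c + 1)))"
        using c s(1) \<open>0 < \<delta>\<close> by (intro mult_mono) auto
      then have "10 * c * ?r \<le> \<delta>" using c by simp
      moreover have "cball x (5 * ?r) \<subseteq> cball x s" by (intro subset_cball) auto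
      ultimately show "\<exists>r. 0 < r \<and> 10 * c * r \<le> \<delta> \<and> r \<le> 1 \<and> cball x (5 * r) \<subseteq> \<Omega> \<inter> T"
        using s c \<open>0 < \<delta>\<close> by (intro exI[of _ ?r]) auto
    qed
    obtain C where C: "countable C" "C \<subseteq> N"
        "pairwise (\<lambda>i j. disjnt (cball i (\<rho> i)) (cball j (\<rho> j))) C"
        "N \<subseteq> (\<Union>i\<in>C. cball i (5 * \<rho> i))"
    proof (rule Vitali_covering_lemma_cballs)
      show "N \<subseteq> (\<Union>x\<in>N. cball x (\<rho> x))" using \<rho> by (force intro: less_imp_le)
      show "0 < \<rho> i \<and> \<rho> i \<le> 1" if "i \<in> N" for i using \<rho> that by auto
    qed
    have "hausdorff_premeasure \<delta> (real ?n) (f ` N) \<le>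
        ennreal (c ^ ?n) * (\<integral>\<^sup>+x. emeasure lborel (cball x (5 * \<rho> x)) \<partial>count_space C)"
    proof (rule hausdorff_premeasure_Lipschitz_balls)
      show "0 < 5 * \<rho> x \<and> 2 * c * (5 * \<rho> x) \<le> \<delta>" if "x \<in> C" for x
        using \<rho>[of x] C(2) that by auto
      show "c-lipschitz_on (cball x (5 * \<rho> x)) f" if "x \<in> C" for x
        using \<rho>[of x] C(2) that by (intro lip) auto
      show "f ` N \<subseteq> (\<Union>x\<in>C. f ` cball x (5 * \<rho> x))"
        using C(4) by (simp add: image_UN[symmetric] image_mono)
    qed (use C(1) \<open>0 < \<delta>\<close> in auto)
    also have "(\<integral>\<^sup>+x. emeasure lborel (cball x (5 * \<rho> x)) \<partial>count_space C)
        = (\<integral>\<^sup>+x. ennreal (5 ^ ?n) * emeasure lborel (cball x (\<rho> x)) \<partial>count_space C)"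
    proof (rule nn_integral_cong)
      fix x assume "x \<in> space (count_space C)"
      then have "0 < \<rho> x" using \<rho> C by auto
      then show "emeasure lborel (cball x (5 * \<rho> x)) = ennreal (5 ^ ?n) * emeasure lborel (cball x (\<rho> x))"
        by (simp add: emeasure_cball power_mult_distrib mult.left_commute del: ennreal_power flip: ennreal_mult')
    qed
    also have "\<dots> = ennreal (5 ^ ?n) * (\<integral>\<^sup>+x. emeasure lborel (cball x (\<rho> x)) \<partial>count_space C)"
      by (simp add: nn_integral_cmult)
    also have "\<dots> \<le> ennreal (5 ^ ?n) * ennreal e'"
    proof (intro mult_left_mono order_trans[OF _ less_imp_le[OF eT]] emeasure_disjoint_cballs_le)
      fix i assume "i \<in> C"
      then have i: "0 < \<rho> i" "cball i (5 * \<rho> i) \<subseteq> \<Omega> \<inter> T"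
        using \<rho> C(2) by blast+
      then have "cball i (\<rho> i) \<subseteq> cball i (5 * \<rho> i)"
        by (intro subset_cball) simp
      with i(2) show "cball i (\<rho> i) \<subseteq> T" by blast
    qed (use C T in auto)
    also have "ennreal (c ^ ?n) * (ennreal (5 ^ ?n) * ennreal e') = ennreal ((5 * c) ^ ?n * e')"
      using c e' by (simp add: power_mult_distrib mult_ac del: ennreal_power flip: ennreal_mult')
    also have "(5 * c) ^ ?n * e' \<le> e"
    proof -
      have "(5 * c) ^ ?n * e \<le> ((5 * c) ^ ?n + 1) * e"
        using \<open>0 < e\<close> by (intro mult_right_mono) auto
      moreover have "0 < (5 * c) ^ ?n + 1" using c by (intro add_nonneg_pos) auto
      ultimately show ?thesis by (simp add: e'_def pos_divide_le_eq mult.commute)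
    qed
    finally show ?thesis using c e' by (simp add: mult_left_mono ennreal_leI)
  qed
  have "hausdorff_premeasure \<delta> (real DIM('a)) (f ` N) \<le> 0"
    by (rule ennreal_le_epsilon) (rule small)
  then show ?thesis by simp
qed

text \<open>Small disjoint balls exhaust \<Omega> up to a null set by Vitali's covering theorem.
  Their volumes add up to at most that of \<Omega>, which keeps the constant exact, and the image of
  the null set contributes nothing. The Lipschitz hypothesis concerns single balls because it is
  applied to domains that are not convex.\<close>

theorem hausdorff_measure_locally_Lipschitz_image:
  fixes f :: "'a::euclidean_space \<Rightarrow> 'b::euclidean_space"
  assumes "open \<Omega>" and lip: "\<And>x r. cball x r \<subseteq> \<Omega> \<Longrightarrow> c-lipschitz_on (cball x r) f"
    and c: "0 \<le> c"
  shows "hausdorff_measure (real DIM('a)) (f ` \<Omega>) \<le> ennreal (c ^ DIM('a)) * emeasure lborel \<Omega>"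
  unfolding hausdorff_measure_def
proof (rule SUP_least)
  fix \<delta> :: real assume "\<delta> \<in> {0<..}"
  then have \<delta>: "0 < \<delta>" by simp
  let ?n = "DIM('a)"
  let ?K = "{(x, r). 0 < r \<and> 2 * c * r \<le> \<delta> \<and> cball x r \<subseteq> \<Omega>}"
  obtain C where C: "countable C" "C \<subseteq> ?K"
      "pairwise (\<lambda>i j. disjnt (cball (fst i) (snd i)) (cball (fst j) (snd j))) C"
      "negligible (\<Omega> - (\<Union>i\<in>C. cball (fst i) (snd i)))"
  proof (rule Vitali_covering_theorem_cballs[of ?K snd \<Omega> fst])
    fix x and d :: real assume x: "x \<in> \<Omega>" "0 < d"
    obtain s where s: "0 < s" "cball x s \<subseteq> \<Omega>"
      using x \<open>open \<Omega>\<close> open_contains_cball by blast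
    \<comment> \<open>The denominator contains \<open>c + 1\<close> instead of \<open>c\<close>
      because \<open>c\<close> may be 0.\<close>
    let ?r = "min s (min (d/2) (\<delta> / (2 * (c + 1))))"
    have "2 * c * ?r \<le> 2 * (c + 1) * (\<delta> / (2 * (c + 1)))"
      using c s(1) \<delta> x by (intro mult_mono) auto
    then have "2 * c * ?r \<le> \<delta>" using c by simp
    moreover have "cball x ?r \<subseteq> cball x s" by (intro subset_cball) auto
    ultimately have "(x, ?r) \<in> ?K" using s c \<delta> x by auto
    moreover have "x \<in> cball x ?r \<and> ?r < d" using s c \<delta> x by auto
    ultimately show "\<exists>i. i \<in> ?K \<and> x \<in> cball (fst i) (snd i) \<and> snd i < d"
      by (intro exI[of _ "(x, ?r)"]) auto
  next
    show "0 < snd i" if "i \<in> ?K" for i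
      using that by auto
  qed
  let ?B = "\<Union>i\<in>C. cball (fst i) (snd i)"
  have "hausdorff_premeasure \<delta> (real ?n) (f ` \<Omega>)
      = hausdorff_premeasure \<delta> (real ?n) (f ` (\<Omega> \<inter> ?B) \<union> f ` (\<Omega> - ?B))"
    by (rule arg_cong[of _ _ "hausdorff_premeasure \<delta> (real ?n)"]) blast
  also have "\<dots> \<le> hausdorff_premeasure \<delta> (real ?n) (f ` (\<Omega> \<inter> ?B)) + hausdorff_premeasure \<delta> (real ?n) (f ` (\<Omega> - ?B))"
    by (rule hausdorff_premeasure_Un_le) (use \<delta> in simp)
  also have "hausdorff_premeasure \<delta> (real ?n) (f ` (\<Omega> - ?B)) = 0"
    by (rule hausdorff_premeasure_image_null[OF assms \<delta> C(4)]) auto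
  also have "hausdorff_premeasure \<delta> (real ?n) (f ` (\<Omega> \<inter> ?B)) \<le>
      ennreal (c ^ ?n) * (\<integral>\<^sup>+i. emeasure lborel (cball (fst i) (snd i)) \<partial>count_space C)"
  proof (rule hausdorff_premeasure_Lipschitz_balls)
    show "0 < snd i \<and> 2 * c * snd i \<le> \<delta>" "c-lipschitz_on (cball (fst i) (snd i)) f" if "i \<in> C" for i
      using C(2) that lip[of "fst i" "snd i"] by auto
  qed (use C(1) \<delta> in auto)
  also have "\<dots> \<le> ennreal (c ^ ?n) * emeasure lborel \<Omega>"
  proof (intro mult_left_mono emeasure_disjoint_cballs_le)
    show "cball (fst i) (snd i) \<subseteq> \<Omega>" if "i \<in> C" for i
      using subsetD[OF C(2) that] by (simp add: case_prod_beta)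
  qed (use C(1,3) \<open>open \<Omega>\<close> in simp_all)
  finally show "hausdorff_premeasure \<delta> (real ?n) (f ` \<Omega>) \<le> ennreal (c ^ ?n) * emeasure lborel \<Omega>"
    by (simp add: add_right_mono)
qed

section \<open>The isodiametric inequality\<close>

text \<open>Fubini's theorem for the region below the graph, cut off at height 1. The cut is present
  because superlevel sets of two functions with supremum 1 are both nonempty exactly at the levels
  below 1, and only those levels are compared.\<close>

lemma nn_integral_min_one_layer_cake:
  assumes [measurable]: "f \<in> borel_measurable (lborel :: real measure)"
  shows "(\<integral>\<^sup>+t. indicator {0<..<1} t * emeasure lborel {x. ennreal t < f x} \<partial>lborel)
    = (\<integral>\<^sup>+x. min (f x) 1 \<partial>(lborel :: real measure))"
proof -
  let ?E = "{z \<in> space (lborel \<Otimes>\<^sub>M lborel). 0 < fst z \<and> fst z < 1 \<and> ennreal (fst z) < f (snd z)} :: (real \<times> real) set"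
  have [measurable]: "?E \<in> sets (lborel \<Otimes>\<^sub>M lborel)" by measurable
  have "(\<integral>\<^sup>+t. indicator {0<..<1} t * emeasure lborel {x. ennreal t < f x} \<partial>lborel)
    = (\<integral>\<^sup>+t. \<integral>\<^sup>+x. indicator ?E (t, x) \<partial>lborel \<partial>lborel)"
  proof (rule nn_integral_cong)
    fix t :: real
    have "(\<integral>\<^sup>+x. indicator ?E (t, x) \<partial>lborel)
        = (\<integral>\<^sup>+x. indicator {0<..<1} t * indicator {x. ennreal t < f x} x \<partial>lborel)"
      by (rule nn_integral_cong) (auto simp: indicator_def space_pair_measure)
    then show "indicator {0<..<1} t * emeasure lborel {x. ennreal t < f x} = (\<integral>\<^sup>+x. indicator ?E (t, x) \<partial>lborel)"
      by (simp add: nn_integral_cmult)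
  qed
  also have "\<dots> = (\<integral>\<^sup>+x. \<integral>\<^sup>+t. indicator ?E (t, x) \<partial>lborel \<partial>lborel)"
    by (rule lborel_pair.Fubini'[symmetric]) measurable
  also have "\<dots> = (\<integral>\<^sup>+x. min (f x) 1 \<partial>lborel)"
  proof (rule nn_integral_cong)
    fix x :: real
    have "(\<integral>\<^sup>+t. indicator ?E (t, x) \<partial>lborel) = (\<integral>\<^sup>+t. indicator {t. 0 < t \<and> t < 1 \<and> ennreal t < f x} t \<partial>lborel)"
      by (rule nn_integral_cong) (auto simp: indicator_def space_pair_measure)
    also have "\<dots> = emeasure lborel {t. 0 < t \<and> t < 1 \<and> ennreal t < f x}"
      by (rule nn_integral_indicator) measurable
    also have "\<dots> = min (f x) 1"
    proof (cases "f x")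
      case (real r)
      then have "{t. 0 < t \<and> t < 1 \<and> ennreal t < f x} = {0<..<min r 1}"
        by (auto simp: ennreal_less_iff)
      then show ?thesis
        using real by (simp add: min_def ennreal_le_1 flip: ennreal_1)
    next
      case top
      then have "{t. 0 < t \<and> t < 1 \<and> ennreal t < f x} = {0<..<1}" by auto
      then show ?thesis using top by simp
    qed
    finally show "(\<integral>\<^sup>+t. indicator ?E (t, x) \<partial>lborel) = min (f x) 1" .
  qed
  finally show ?thesis .
qed

text \<open>For \<open>a\<close> close to the supremum of \<open>A\<close> and \<open>b\<close> close to the infimum of \<open>B\<close> the translates
  \<open>A + b\<close> and \<open>a + B\<close> are almost disjoint.\<close>

lemma Brunn_Minkowski_real:
  fixes A B C :: "real set"
  assumes [measurable]: "A \<in> sets lborel" "B \<in> sets lborel" "C \<in> sets lborel"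
    and "A \<noteq> {}" "B \<noteq> {}" "bounded A" "bounded B"
    and sub: "\<And>x y. x \<in> A \<Longrightarrow> y \<in> B \<Longrightarrow> (x + y) / 2 \<in> C"
  shows "emeasure lborel A + emeasure lborel B \<le> 2 * emeasure lborel C"
proof (rule ennreal_le_epsilon)
  fix e :: real assume "0 < e"
  have bdd: "bdd_above A" "bdd_below B"
    using assms by (auto intro: bounded_imp_bdd_above bounded_imp_bdd_below)
  obtain a where a: "a \<in> A" "Sup A - e/2 < a"
    using less_cSup_iff[OF \<open>A \<noteq> {}\<close> bdd(1), of "Sup A - e/2"] \<open>0 < e\<close> by auto
  obtain b where b: "b \<in> B" "b < Inf B + e/2"
    using cInf_less_iff[OF \<open>B \<noteq> {}\<close> bdd(2), of "Inf B + e/2"] \<open>0 < e\<close> by auto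
  have bounds: "x \<le> Sup A" "Inf B \<le> y" if "x \<in> A" "y \<in> B" for x y
    using that bdd by (auto intro: cSup_upper cInf_lower)
  have affine: "emeasure lborel S = ennreal \<bar>c\<bar> * (\<integral>\<^sup>+u. indicator S (t + c * u) \<partial>lborel)"
    if "S \<in> sets lborel" "c \<noteq> 0" for S :: "real set" and c t
    using that nn_integral_real_affine[of "indicator S" c t] by simp
  have "emeasure lborel A + emeasure lborel B
      = (\<integral>\<^sup>+u. indicator A (- b + u) + indicator B (- a + u) \<partial>lborel)"
    using assms(1,2) affine[of A 1 "- b"] affine[of B 1 "- a"] by (simp add: nn_integral_add)
  also have "\<dots> \<le> (\<integral>\<^sup>+u. indicator C (0 + 1/2 * u) + indicator {a + Inf B..b + Sup A} u \<partial>lborel)"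
  proof (rule nn_integral_mono)
    fix u :: real
    \<comment> \<open>Membership of \<open>u\<close> in either translate makes \<open>u / 2\<close>
      a midpoint, hence a point of \<open>C\<close>. If \<open>u\<close> lies in both translates,
      the indicator sum is 2, and the excess is absorbed by an interval of length at most
      \<open>e\<close>.\<close>
    have "u / 2 \<in> C" if "- b + u \<in> A \<or> - a + u \<in> B"
      using that sub[of "- b + u" b] sub[of a "- a + u"] a b by auto
    moreover have "u \<in> {a + Inf B..b + Sup A}" if "- b + u \<in> A" "- a + u \<in> B"
      using bounds[OF that] by auto
    ultimately show "indicator A (- b + u) + indicator B (- a + u)
        \<le> (indicator C (0 + 1/2 * u) + indicator {a + Inf B..b + Sup A} u :: ennreal)"
      by (auto simp: indicator_def)
  qed
  also have "\<dots> = (\<integral>\<^sup>+u. indicator C (0 + 1/2 * u) \<partial>lborel) + emeasure lborel {a + Inf B..b + Sup A}"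
    by (simp add: nn_integral_add)
  also have "(\<integral>\<^sup>+u. indicator C (0 + 1/2 * u) \<partial>lborel) = 2 * emeasure lborel C"
  proof -
    have "2 * ennreal \<bar>1/2\<bar> = ennreal (2 * (1/2))"
      by (subst ennreal_mult) simp_all
    then have "2 * ennreal \<bar>1/2\<bar> = 1" by simp
    moreover have "2 * emeasure lborel C = (2 * ennreal \<bar>1/2\<bar>) * (\<integral>\<^sup>+u. indicator C (0 + 1/2 * u) \<partial>lborel)"
      unfolding mult.assoc using assms(3) by (subst affine[of C "1/2" 0]) simp_all
    ultimately show ?thesis by simp
  qed
  also have "emeasure lborel {a + Inf B..b + Sup A} \<le> ennreal e"
    using a b bounds[OF a(1) b(1)] by (auto intro!: ennreal_leI)
  finally show "emeasure lborel A + emeasure lborel B \<le> 2 * emeasure lborel C + ennreal e"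
    by (simp add: add_left_mono)
qed

text \<open>Scaling \<open>f\<close> and \<open>g\<close> to supremum 1 makes their superlevel sets
  nonempty at every level below 1, so the one-dimensional Brunn-Minkowski inequality applies level
  by level. Integration over the levels gives an additive inequality, and the arithmetic-geometric
  mean inequality turns it into the multiplicative one. The single bound \<open>m\<close> on heights
  and supports makes the suprema finite and the superlevel sets bounded.\<close>

lemma Prekopa_Leindler_real_bounded:
  fixes f g h :: "real \<Rightarrow> ennreal"
  assumes [measurable]: "f \<in> borel_measurable lborel" "g \<in> borel_measurable lborel" "h \<in> borel_measurable lborel"
    and le: "\<And>x y. f x * g y \<le> (h ((x + y) / 2))\<^sup>2"
    and bd: "\<And>x. f x \<le> ennreal m" "\<And>x. g x \<le> ennreal m"
    and supp: "\<And>x. m < \<bar>x\<bar> \<Longrightarrow> f x = 0" "\<And>x. m < \<bar>x\<bar> \<Longrightarrow> g x = 0"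
  shows "(\<integral>\<^sup>+x. f x \<partial>lborel) * (\<integral>\<^sup>+x. g x \<partial>lborel) \<le> (\<integral>\<^sup>+x. h x \<partial>lborel)\<^sup>2"
proof -
  have sup_le: "(SUP x. f x) \<le> ennreal m" "(SUP x. g x) \<le> ennreal m"
    using bd by (auto intro: SUP_least)
  obtain a where a: "0 \<le> a" "(SUP x. f x) = ennreal a"
    using sup_le(1) by (cases "SUP x. f x") (auto simp: top_unique)
  obtain b where b: "0 \<le> b" "(SUP x. g x) = ennreal b"
    using sup_le(2) by (cases "SUP x. g x") (auto simp: top_unique)
  have fa: "f x \<le> ennreal a" and gb: "g x \<le> ennreal b" for x
    unfolding a(2)[symmetric] b(2)[symmetric] by (auto intro: SUP_upper)
  show ?thesis
  proof (cases "a = 0 \<or> b = 0")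
    case True
    then have "(\<forall>x. f x = 0) \<or> (\<forall>x. g x = 0)" using fa gb by auto
    then show ?thesis by auto
  next
    case False
    with a b have pos: "0 < a" "0 < b" by auto
    \<comment> \<open>Since \<open>h\<close> enters the hypothesis squared, it is scaled by the
      geometric mean of the two factors; the hypothesis then holds for the scaled functions.\<close>
    let ?F = "\<lambda>x. ennreal (1/a) * f x" and ?G = "\<lambda>x. ennreal (1/b) * g x"
      and ?H = "\<lambda>x. ennreal (1/sqrt (a * b)) * h x"
    have F1: "?F x \<le> 1" for x
      using mult_left_mono[OF fa, of "ennreal (1/a)" x] pos by (simp flip: ennreal_mult')
    have G1: "?G x \<le> 1" for x
      using mult_left_mono[OF gb, of "ennreal (1/b)" x] pos by (simp flip: ennreal_mult')
    have level: "emeasure lborel {x. ennreal t < ?F x} + emeasure lborel {x. ennreal t < ?G x}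
        \<le> 2 * emeasure lborel {x. ennreal t < ?H x}" if t: "0 < t" "t < 1" for t
    proof (rule Brunn_Minkowski_real)
      have nonempty: "\<exists>x. ennreal t < ennreal (1/s) * u x" if "0 < s" "(SUP x. u x) = ennreal s" for s and u :: "real \<Rightarrow> ennreal"
      proof -
        have "ennreal (t * s) < (SUP x. u x)"
          using t that by (simp add: ennreal_less_iff)
        then obtain x where "ennreal (t * s) < u x" by (auto simp: less_SUP_iff)
        then have "ennreal t < ennreal (1/s) * u x"
          using t that by (cases "u x") (auto simp: ennreal_less_iff ennreal_mult_top field_simps simp flip: ennreal_mult)
        then show ?thesis ..
      qed
      show "{x. ennreal t < ?F x} \<noteq> {}" "{x. ennreal t < ?G x} \<noteq> {}"
        using nonempty[OF pos(1) a(2)] nonempty[OF pos(2) b(2)] by auto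
      show "bounded {x. ennreal t < ?F x}" "bounded {x. ennreal t < ?G x}"
        by (rule bounded_subset[OF bounded_cball[of 0 m]]; use supp in \<open>force simp: not_le[symmetric]\<close>)+
      fix x y assume xy: "x \<in> {x. ennreal t < ?F x}" "y \<in> {x. ennreal t < ?G x}"
      obtain p q where p: "0 \<le> p" "?F x = ennreal p" and q: "0 \<le> q" "?G y = ennreal q"
        using F1[of x] G1[of y] by (cases "?F x"; cases "?G y") (auto simp: top_unique)
      have "t < p" "t < q" using xy p q t by (auto simp: ennreal_less_iff)
      then have "t * t < p * q" using t by (intro mult_strict_mono) auto
      then have "ennreal (t * t) < ?F x * ?G y"
        using p q t by (simp add: ennreal_less_iff flip: ennreal_mult)
      also have "\<dots> = ennreal (1/a) * ennreal (1/b) * (f x * g y)" by (simp add: mult_ac)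
      also have "ennreal (1/a) * ennreal (1/b) = (ennreal (1/sqrt (a * b)))\<^sup>2"
        using pos by (simp add: power2_eq_square flip: ennreal_mult)
      also have "(ennreal (1/sqrt (a * b)))\<^sup>2 * (f x * g y) \<le> (ennreal (1/sqrt (a * b)))\<^sup>2 * (h ((x + y) / 2))\<^sup>2"
        using le by (rule mult_left_mono) simp
      also have "\<dots> = (?H ((x + y) / 2))\<^sup>2" by (simp add: power_mult_distrib)
      finally have *: "ennreal (t * t) < (?H ((x + y) / 2))\<^sup>2" .
      show "(x + y) / 2 \<in> {x. ennreal t < ?H x}"
      proof (rule ccontr)
        assume "\<not> ?thesis"
        then have "?H ((x + y) / 2) \<le> ennreal t" by (simp add: not_less)
        then have "(?H ((x + y) / 2))\<^sup>2 \<le> (ennreal t)\<^sup>2" by (rule power_mono) simp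
        with * t show False by (simp add: power2_eq_square ennreal_mult)
      qed
    qed measurable
    have "(\<integral>\<^sup>+x. ?F x \<partial>lborel) + (\<integral>\<^sup>+x. ?G x \<partial>lborel) = (\<integral>\<^sup>+x. min (?F x) 1 \<partial>lborel) + (\<integral>\<^sup>+x. min (?G x) 1 \<partial>lborel)"
      using F1 G1 by (simp add: min_absorb1)
    also have "\<dots> = (\<integral>\<^sup>+t. indicator {0<..<1} t * emeasure lborel {x. ennreal t < ?F x}
        + indicator {0<..<1} t * emeasure lborel {x. ennreal t < ?G x} \<partial>lborel)"
      by (subst (1 2) nn_integral_min_one_layer_cake[symmetric], measurable)
        (rule nn_integral_add[symmetric]; measurable)
    also have "\<dots> \<le> (\<integral>\<^sup>+t. 2 * (indicator {0<..<1} t * emeasure lborel {x. ennreal t < ?H x}) \<partial>lborel)"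
      using level by (intro nn_integral_mono) (auto simp: indicator_def)
    also have "\<dots> = 2 * (\<integral>\<^sup>+x. min (?H x) 1 \<partial>lborel)"
      by (subst nn_integral_min_one_layer_cake[symmetric], measurable) (rule nn_integral_cmult; measurable)
    also have "\<dots> \<le> 2 * (\<integral>\<^sup>+x. ?H x \<partial>lborel)"
      by (intro mult_left_mono nn_integral_mono) auto
    finally have sum: "(\<integral>\<^sup>+x. ?F x \<partial>lborel) + (\<integral>\<^sup>+x. ?G x \<partial>lborel) \<le> 2 * (\<integral>\<^sup>+x. ?H x \<partial>lborel)" .
    have amgm: "4 * (x * y) \<le> (x + y)\<^sup>2" for x y :: ennreal
    proof (cases "x = top \<or> y = top")
      case True
      then show ?thesis by (auto simp: power2_eq_square)
    next
      case False
      then obtain p q where pq: "0 \<le> p" "x = ennreal p" "0 \<le> q" "y = ennreal q"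
        by (metis ennreal_cases)
      have "4 * (p * q) \<le> (p + q)\<^sup>2"
        using zero_le_power2[of "p - q"] by (simp add: power2_eq_square algebra_simps)
      then have "ennreal (4 * (p * q)) \<le> ennreal ((p + q)\<^sup>2)" by (rule ennreal_leI)
      then show ?thesis using pq by (simp add: ennreal_mult ennreal_power[symmetric])
    qed
    have "4 * ((\<integral>\<^sup>+x. ?F x \<partial>lborel) * (\<integral>\<^sup>+x. ?G x \<partial>lborel)) \<le> ((\<integral>\<^sup>+x. ?F x \<partial>lborel) + (\<integral>\<^sup>+x. ?G x \<partial>lborel))\<^sup>2"
      by (rule amgm)
    also have "\<dots> \<le> (2 * (\<integral>\<^sup>+x. ?H x \<partial>lborel))\<^sup>2"
      using sum by (rule power_mono) simp
    also have "\<dots> = 4 * (\<integral>\<^sup>+x. ?H x \<partial>lborel)\<^sup>2" by (simp add: power_mult_distrib)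
    finally have FG: "(\<integral>\<^sup>+x. ?F x \<partial>lborel) * (\<integral>\<^sup>+x. ?G x \<partial>lborel) \<le> (\<integral>\<^sup>+x. ?H x \<partial>lborel)\<^sup>2"
      by (subst (asm) ennreal_mult_le_mult_iff) auto
    have rescale: "(\<integral>\<^sup>+x. u x \<partial>lborel) = ennreal s * (\<integral>\<^sup>+x. ennreal (1/s) * u x \<partial>lborel)"
      if "0 < s" "u \<in> borel_measurable lborel" for s and u :: "real \<Rightarrow> ennreal"
      using that by (simp add: nn_integral_cmult flip: mult.assoc ennreal_mult)
    have "(\<integral>\<^sup>+x. f x \<partial>lborel) * (\<integral>\<^sup>+x. g x \<partial>lborel)
        = ennreal (a * b) * ((\<integral>\<^sup>+x. ?F x \<partial>lborel) * (\<integral>\<^sup>+x. ?G x \<partial>lborel))"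
      using pos by (subst rescale[of a f], simp, simp, subst rescale[of b g], simp, simp) (simp add: ennreal_mult mult_ac)
    also have "\<dots> \<le> ennreal (a * b) * (\<integral>\<^sup>+x. ?H x \<partial>lborel)\<^sup>2"
      using FG by (rule mult_left_mono) simp
    also have "\<dots> = (ennreal (sqrt (a * b)) * (\<integral>\<^sup>+x. ?H x \<partial>lborel))\<^sup>2"
      using pos by (simp add: power_mult_distrib ennreal_power)
    also have "\<dots> = (\<integral>\<^sup>+x. h x \<partial>lborel)\<^sup>2"
      using pos by (subst rescale[of "sqrt (a * b)" h]) auto
    finally show ?thesis .
  qed
qed

text \<open>Cutting \<open>f\<close> and \<open>g\<close> off in height and to
  \<open>{- real m..real m}\<close> only decreases them, so the hypothesis survives with the same
  \<open>h\<close>; monotone convergence then removes the cut.\<close>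

lemma Prekopa_Leindler_real:
  fixes f g h :: "real \<Rightarrow> ennreal"
  assumes [measurable]: "f \<in> borel_measurable lborel" "g \<in> borel_measurable lborel" "h \<in> borel_measurable lborel"
    and le: "\<And>x y. f x * g y \<le> (h ((x + y) / 2))\<^sup>2"
  shows "(\<integral>\<^sup>+x. f x \<partial>lborel) * (\<integral>\<^sup>+x. g x \<partial>lborel) \<le> (\<integral>\<^sup>+x. h x \<partial>lborel)\<^sup>2"
proof -
  define trunc where "trunc m u x = min (u x) (ennreal (real m)) * indicator {- real m..real m} x"
    for m and u :: "real \<Rightarrow> ennreal" and x
  have trunc_le: "trunc m u x \<le> u x" for m u x
    by (auto simp: trunc_def indicator_def)
  have trunc_mono: "trunc m u x \<le> trunc k u x" if "m \<le> k" for m k u x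
    using that by (auto simp: trunc_def indicator_def min_def ennreal_leI intro: order_trans)
  have trunc_meas[measurable]: "trunc m u \<in> borel_measurable lborel" if [measurable]: "u \<in> borel_measurable lborel" for m u
    unfolding trunc_def by measurable
  have SUP_trunc: "(SUP m. trunc m u x) = u x" for u x
  proof (rule antisym)
    show "(SUP m. trunc m u x) \<le> u x" by (rule SUP_least) (rule trunc_le)
    show "u x \<le> (SUP m. trunc m u x)"
    proof (rule dense_le)
      fix y assume "y < u x"
      then obtain r where r: "y = ennreal r" "0 \<le> r" by (cases y) auto
      obtain m where m: "max r \<bar>x\<bar> \<le> real m" using real_arch_simple by blast
      have "y \<le> trunc m u x"
        using m r \<open>y < u x\<close>
        by (auto simp: trunc_def abs_le_iff min_def indicator_def ennreal_leI intro: less_imp_le)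
      then show "y \<le> (SUP m. trunc m u x)" by (rule order_trans) (rule SUP_upper, simp)
    qed
  qed
  have int: "(\<integral>\<^sup>+x. u x \<partial>lborel) = (SUP m. \<integral>\<^sup>+x. trunc m u x \<partial>lborel)" if "u \<in> borel_measurable lborel" for u
  proof -
    have "(\<integral>\<^sup>+x. u x \<partial>lborel) = (\<integral>\<^sup>+x. (SUP m. trunc m u x) \<partial>lborel)" by (simp add: SUP_trunc)
    also have "\<dots> = (SUP m. \<integral>\<^sup>+x. trunc m u x \<partial>lborel)"
      using that trunc_mono
      by (intro nn_integral_monotone_convergence_SUP) (auto simp: incseq_def le_fun_def)
    finally show ?thesis .
  qed
  \<comment> \<open>The product of two suprema unfolds into a double supremum, hence two independent
    truncation levels; both are raised to the larger one.\<close>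
  have bound: "(\<integral>\<^sup>+x. trunc m f x \<partial>lborel) * (\<integral>\<^sup>+x. trunc k g x \<partial>lborel) \<le> (\<integral>\<^sup>+x. h x \<partial>lborel)\<^sup>2" for m k
  proof -
    let ?n = "max m k"
    have "(\<integral>\<^sup>+x. trunc m f x \<partial>lborel) * (\<integral>\<^sup>+x. trunc k g x \<partial>lborel)
        \<le> (\<integral>\<^sup>+x. trunc ?n f x \<partial>lborel) * (\<integral>\<^sup>+x. trunc ?n g x \<partial>lborel)"
      by (intro mult_mono nn_integral_mono trunc_mono) auto
    also have "\<dots> \<le> (\<integral>\<^sup>+x. h x \<partial>lborel)\<^sup>2"
    proof (rule Prekopa_Leindler_real_bounded[where m = "real ?n"])
      show "trunc ?n f x * trunc ?n g y \<le> (h ((x + y) / 2))\<^sup>2" for x y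
        using mult_mono[OF trunc_le[of ?n f x] trunc_le[of ?n g y]] le[of x y] by (auto intro: order_trans)
    qed (auto simp: trunc_def indicator_def)
    finally show ?thesis .
  qed
  show ?thesis
    unfolding int[OF assms(1)] int[OF assms(2)] SUP_mult_right_ennreal SUP_mult_left_ennreal
    by (intro SUP_least bound)
qed

text \<open>The inequality is inherited by marginals: for fixed values \<open>s\<close> and
  \<open>t\<close> of the new coordinate, the induction hypothesis says that the partial integrals
  of \<open>f\<close>, \<open>g\<close> and \<open>h\<close> satisfy the one-dimensional
  hypothesis.\<close>

lemma Prekopa_Leindler_PiM:
  fixes f g h :: "('i \<Rightarrow> real) \<Rightarrow> ennreal"
  assumes "finite I"
    and "f \<in> borel_measurable (Pi\<^sub>M I (\<lambda>_. lborel))" "g \<in> borel_measurable (Pi\<^sub>M I (\<lambda>_. lborel))"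
      "h \<in> borel_measurable (Pi\<^sub>M I (\<lambda>_. lborel))"
    and "\<And>x y. x \<in> extensional I \<Longrightarrow> y \<in> extensional I \<Longrightarrow> f x * g y \<le> (h (\<lambda>i\<in>I. (x i + y i) / 2))\<^sup>2"
  shows "(\<integral>\<^sup>+x. f x \<partial>Pi\<^sub>M I (\<lambda>_. lborel)) * (\<integral>\<^sup>+x. g x \<partial>Pi\<^sub>M I (\<lambda>_. lborel))
    \<le> (\<integral>\<^sup>+x. h x \<partial>Pi\<^sub>M I (\<lambda>_. lborel))\<^sup>2"
  using assms
proof (induction I arbitrary: f g h rule: finite_induct)
  case empty
  interpret product_sigma_finite "\<lambda>_::'i. lborel :: real measure" by standard
  show ?case
    \<comment> \<open>The product measure over no coordinates is a unit mass at the everywhere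
      undefined function.\<close>
    using empty(4)[of "\<lambda>_. undefined" "\<lambda>_. undefined"] by (simp add: nn_integral_empty restrict_def)
next
  case (insert i I)
  interpret product_sigma_finite "\<lambda>_::'i. lborel :: real measure" by standard
  interpret I: finite_product_sigma_finite "\<lambda>_::'i. lborel :: real measure" I by standard (rule insert)
  note [measurable] = insert.prems(1-3)
  have meas[measurable]: "(\<lambda>s. \<integral>\<^sup>+x. u (x(i := s)) \<partial>Pi\<^sub>M I (\<lambda>_. lborel)) \<in> borel_measurable lborel"
    if [measurable]: "u \<in> borel_measurable (Pi\<^sub>M (insert i I) (\<lambda>_. lborel))" for u :: "('i \<Rightarrow> real) \<Rightarrow> ennreal"
    by measurable
  have "(\<integral>\<^sup>+s. (\<integral>\<^sup>+x. f (x(i := s)) \<partial>Pi\<^sub>M I (\<lambda>_. lborel)) \<partial>lborel) * (\<integral>\<^sup>+s. (\<integral>\<^sup>+x. g (x(i := s)) \<partial>Pi\<^sub>M I (\<lambda>_. lborel)) \<partial>lborel)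
      \<le> (\<integral>\<^sup>+s. (\<integral>\<^sup>+x. h (x(i := s)) \<partial>Pi\<^sub>M I (\<lambda>_. lborel)) \<partial>lborel)\<^sup>2"
  proof (rule Prekopa_Leindler_real)
    fix s t :: real
    show "(\<integral>\<^sup>+x. f (x(i := s)) \<partial>Pi\<^sub>M I (\<lambda>_. lborel)) * (\<integral>\<^sup>+x. g (x(i := t)) \<partial>Pi\<^sub>M I (\<lambda>_. lborel))
      \<le> (\<integral>\<^sup>+x. h (x(i := (s + t) / 2)) \<partial>Pi\<^sub>M I (\<lambda>_. lborel))\<^sup>2"
    proof (rule insert.IH)
      have extensional_fun_upd_insert: "u(i := r) \<in> extensional (insert i I)" if "u \<in> extensional I"
        for u :: "'i \<Rightarrow> real" and r
        using that by (auto simp: extensional_def)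
      fix x y :: "'i \<Rightarrow> real" assume xy: "x \<in> extensional I" "y \<in> extensional I"
      have "(\<lambda>j\<in>insert i I. ((x(i := s)) j + (y(i := t)) j) / 2) = (\<lambda>j\<in>I. (x j + y j) / 2)(i := (s + t) / 2)"
        using insert(2) by (auto simp: fun_eq_iff)
      then show "f (x(i := s)) * g (y(i := t)) \<le> (h ((\<lambda>j\<in>I. (x j + y j) / 2)(i := (s + t) / 2)))\<^sup>2"
        using insert.prems(4)[of "x(i := s)" "y(i := t)"] xy
        by (simp only: extensional_fun_upd_insert)
    qed measurable
  qed measurable
  then show ?case
    using insert by (simp add: product_nn_integral_insert_rev)
qed

lemma Prekopa_Leindler:
  fixes f g h :: "'a::euclidean_space \<Rightarrow> ennreal"
  assumes [measurable]: "f \<in> borel_measurable borel" "g \<in> borel_measurable borel" "h \<in> borel_measurable borel"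
    and le: "\<And>x y. f x * g y \<le> (h ((1/2) *\<^sub>R (x + y)))\<^sup>2"
  shows "(\<integral>\<^sup>+x. f x \<partial>lborel) * (\<integral>\<^sup>+x. g x \<partial>lborel) \<le> (\<integral>\<^sup>+x. h x \<partial>lborel)\<^sup>2"
proof -
  let ?\<phi> = "\<lambda>x. \<Sum>b\<in>Basis. x b *\<^sub>R b :: 'a"
  have "(\<integral>\<^sup>+x. f (?\<phi> x) \<partial>Pi\<^sub>M Basis (\<lambda>_. lborel)) * (\<integral>\<^sup>+x. g (?\<phi> x) \<partial>Pi\<^sub>M Basis (\<lambda>_. lborel))
      \<le> (\<integral>\<^sup>+x. h (?\<phi> x) \<partial>Pi\<^sub>M Basis (\<lambda>_. lborel))\<^sup>2"
  proof (rule Prekopa_Leindler_PiM)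
    fix x y :: "'a \<Rightarrow> real"
    have "?\<phi> (\<lambda>i\<in>Basis. (x i + y i) / 2) = (1/2) *\<^sub>R (?\<phi> x + ?\<phi> y)"
      by (simp add: scaleR_sum_right algebra_simps add_divide_distrib sum.distrib)
    then show "f (?\<phi> x) * g (?\<phi> y) \<le> (h (?\<phi> (\<lambda>i\<in>Basis. (x i + y i) / 2)))\<^sup>2"
      using le by simp
  qed measurable
  then show ?thesis
    by (subst (1 2 3) lborel_eq) (simp add: nn_integral_distr)
qed

text \<open>A set of diameter \<open>d\<close> need not lie in a ball of radius
  \<open>d / 2\<close>, but its symmetrisation does: each point of \<open>?C\<close> is half the
  difference of two points of \<open>A\<close>. Symmetrisation does not decrease the volume, because
  \<open>A\<close> and its reflection have equal volume and \<open>?C\<close> consists of their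
  midpoints. Compactness of \<open>A\<close> makes \<open>?C\<close> measurable and of finite
  volume, so that squares can be compared.\<close>

theorem isodiametric_inequality:
  fixes A :: "'a::euclidean_space set"
  assumes "compact A" "A \<noteq> {}"
  shows "emeasure lborel A \<le> ennreal (unit_ball_vol (real DIM('a)) * (diameter A / 2) ^ DIM('a))"
proof -
  let ?B = "uminus ` A" and ?C = "(\<lambda>(x, y). (1/2) *\<^sub>R (x - y)) ` (A \<times> A)"
  have C: "compact ?C" 
    using assms by (intro compact_continuous_image compact_Times) (auto intro!: continuous_intros simp: case_prod_beta)
  have B: "compact ?B" using assms by (simp add: compact_negations)
  have m[measurable]: "A \<in> sets borel" "?B \<in> sets borel" "?C \<in> sets borel"
    using assms C B by (auto intro: borel_compact)
  have "distr lborel borel uminus = (lborel :: 'a measure)"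
    by (subst lborel_affine[of "-1" 0]) (auto simp: density_1 simp flip: one_ennreal_def)
  then have "emeasure lborel ?B = emeasure (distr lborel borel uminus) ?B" by simp
  also have "\<dots> = emeasure lborel A"
    using m by (subst emeasure_distr) (auto simp: vimage_def image_iff intro!: arg_cong[of _ _ "emeasure lborel"])
  finally have "emeasure lborel A * emeasure lborel A = emeasure lborel A * emeasure lborel ?B" by simp
  also have "\<dots> \<le> (emeasure lborel ?C)\<^sup>2"
  proof -
    have "indicator A x * indicator ?B y \<le> (indicator ?C ((1/2) *\<^sub>R (x + y)) :: ennreal)\<^sup>2" for x y
      by (auto simp: indicator_def image_iff case_prod_beta) (metis (full_types) diff_minus_eq_add minus_minus mem_Sigma_iff fst_conv snd_conv)
    with m have "(\<integral>\<^sup>+x. indicator A x \<partial>lborel) * (\<integral>\<^sup>+x. indicator ?B x \<partial>lborel)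
        \<le> (\<integral>\<^sup>+x. indicator ?C x \<partial>lborel)\<^sup>2"
      by (intro Prekopa_Leindler) auto
    then show ?thesis using m by simp
  qed
  finally have sq: "emeasure lborel A * emeasure lborel A \<le> (emeasure lborel ?C)\<^sup>2" .
  have d: "0 \<le> diameter A" using assms by (intro diameter_ge_0 compact_imp_bounded)
  have "?C \<subseteq> cball 0 (diameter A / 2)"
    using diameter_bounded_bound[OF compact_imp_bounded[OF assms(1)]] by (auto simp: dist_norm)
  then have "emeasure lborel ?C \<le> emeasure lborel (cball 0 (diameter A / 2) :: 'a set)"
    by (rule emeasure_mono) auto
  also have "\<dots> = ennreal (unit_ball_vol (real DIM('a)) * (diameter A / 2) ^ DIM('a))"
    using d by (intro emeasure_cball) auto
  finally have C_le: "emeasure lborel ?C \<le> \<dots>" .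
  have "emeasure lborel A < top" using emeasure_compact_finite[OF assms(1)] by (simp add: less_top)
  moreover have "emeasure lborel ?C < top" using emeasure_compact_finite[OF C] by (simp add: less_top)
  ultimately have "emeasure lborel A \<le> emeasure lborel ?C"
    using sq by (cases "emeasure lborel A"; cases "emeasure lborel ?C")
      (auto simp: power2_eq_square intro: power2_le_imp_le[unfolded power2_eq_square] simp flip: ennreal_mult)
  then show ?thesis using C_le by (rule order_trans)
qed

section \<open>Affine subspaces\<close>

text \<open>The preimage under an isometry of a covering set has no larger diameter, so the
  isodiametric inequality bounds its volume by the weight of that set, whatever its shape.\<close>

lemma hausdorff_measure_isometric_ball:
  fixes J :: "'a::euclidean_space \<Rightarrow> 'b::euclidean_space"
  assumes J: "\<And>x y. dist (J x) (J y) = dist x y" and "0 \<le> r"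
  shows "hausdorff_measure (real DIM('a)) (J ` ball a r) = ennreal (unit_ball_vol (real DIM('a)) * r ^ DIM('a))"
proof (rule antisym)
  let ?n = "DIM('a)"
  have "hausdorff_measure (real ?n) (J ` ball a r) \<le> ennreal (1 ^ ?n) * emeasure lborel (ball a r)"
    by (rule hausdorff_measure_locally_Lipschitz_image) (auto simp: lipschitz_on_def J)
  then show "hausdorff_measure (real ?n) (J ` ball a r) \<le> ennreal (unit_ball_vol (real ?n) * r ^ ?n)"
    using assms by (simp add: emeasure_ball)
  \<comment> \<open>Any scale would do, since the isodiametric inequality holds for sets of every
    size and the measure dominates the premeasure at each positive scale.\<close>
  have "emeasure lborel (ball a r) \<le> hausdorff_premeasure 1 (real ?n) (J ` ball a r)"
    unfolding hausdorff_premeasure_def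
  proof (rule INF_greatest, elim CollectE conjE)
    fix C :: "nat \<Rightarrow> 'b set"
    assume cov: "J ` ball a r \<subseteq> (\<Union>i. C i)" and C: "\<forall>i. bounded (C i) \<and> diameter (C i) \<le> 1"
    \<comment> \<open>A covering set may be non-measurable; the closure of its preimage is compact
      and has the same diameter as the preimage.\<close>
    have D: "emeasure lborel (closure (J -` C i)) \<le> hausdorff_weight (real ?n) (C i)" for i
    proof (cases "J -` C i = {}")
      case False
      let ?D = "J -` C i"
      have bC: "bounded (C i)" using C by simp
      have le: "dist x y \<le> diameter (C i)" if "x \<in> ?D" "y \<in> ?D" for x y
        using diameter_bounded_bound[OF bC, of "J x" "J y"] that by (simp add: J)
      have bD: "bounded ?D" using False le unfolding bounded_def by blast
      have diam: "diameter ?D \<le> diameter (C i)"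
        using False le by (intro diameter_le) (auto simp: dist_norm)
      have "emeasure lborel (closure ?D) \<le> ennreal (unit_ball_vol (real ?n) * (diameter (closure ?D) / 2) ^ ?n)"
        using bD False by (intro isodiametric_inequality) auto
      also have "\<dots> \<le> ennreal (unit_ball_vol (real ?n) * (diameter (C i) / 2) ^ ?n)"
        using diam diameter_ge_0[OF bD]
        by (intro ennreal_leI mult_left_mono power_mono) (auto simp: diameter_closure[OF bD])
      also have "(diameter (C i) / 2) ^ ?n = (diameter (C i) / 2) powr real ?n"
        using diameter_ge_0[OF bC] by (cases "diameter (C i) = 0") (auto simp: powr_realpow)
      finally show ?thesis using False by (auto simp: hausdorff_weight_def)
    qed simp
    have "emeasure lborel (ball a r) \<le> emeasure lborel (\<Union>i. closure (J -` C i))"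
    proof (rule emeasure_mono)
      show "ball a r \<subseteq> (\<Union>i. closure (J -` C i))"
      proof
        fix x assume "x \<in> ball a r"
        then obtain i where "J x \<in> C i" using cov by blast
        then have "x \<in> closure (J -` C i)" by (intro subsetD[OF closure_subset]) simp
        then show "x \<in> (\<Union>i. closure (J -` C i))" by blast
      qed
    qed auto
    also have "\<dots> \<le> (\<Sum>i. emeasure lborel (closure (J -` C i)))"
      by (rule emeasure_subadditive_countably) auto
    also have "\<dots> \<le> (\<Sum>i. hausdorff_weight (real ?n) (C i))"
      using D by (intro suminf_le) auto
    finally show "emeasure lborel (ball a r) \<le> (\<Sum>i. hausdorff_weight (real ?n) (C i))" .
  qed
  also have "\<dots> \<le> hausdorff_measure (real ?n) (J ` ball a r)"
    unfolding hausdorff_measure_def by (rule SUP_upper) simp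
  finally show "ennreal (unit_ball_vol (real ?n) * r ^ ?n) \<le> hausdorff_measure (real ?n) (J ` ball a r)"
    using assms by (simp add: emeasure_ball)
qed

lemma density_ratio_isometric_range:
  fixes J :: "'a::euclidean_space \<Rightarrow> 'b::euclidean_space"
  assumes J: "\<And>x y. dist (J x) (J y) = dist x y" and "p \<in> range J" "0 < r"
  shows "density_ratio DIM('a) (range J) p r = 1"
proof -
  obtain a where a: "p = J a" using assms(2) by auto
  have "range J \<inter> ball p r = J ` ball a r" by (auto simp: a J)
  moreover have "0 < unit_ball_vol (real DIM('a)) * r ^ DIM('a)" using assms(3) by simp
  ultimately show ?thesis
    using assms(3) unit_ball_vol_pos[of "real DIM('a)"] by (simp del: unit_ball_vol_pos add: density_ratio_def hausdorff_measure_isometric_ball[OF J] divide_ennreal)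
qed

section \<open>Orthogonal projections onto subspaces\<close>

lemma closest_point_subspace_in: "subspace L \<Longrightarrow> closest_point L x \<in> (L :: 'a::euclidean_space set)"
  using closest_point_in_set[OF closed_subspace] subspace_0 by blast

lemma closest_point_subspace_orthogonal:
  fixes L :: "'a::euclidean_space set"
  assumes L: "subspace L" and v: "v \<in> L"
  shows "(x - closest_point L x) \<bullet> v = 0"
proof -
  let ?c = "closest_point L x"
  have "(x - ?c) \<bullet> (y - ?c) \<le> 0" if "y \<in> L" for y
    using that L by (intro closest_point_dot subspace_imp_convex closed_subspace)
  \<comment> \<open>The obtuse-angle inequality for projections, tested at both points, bounds the
    inner product with \<open>v\<close> by 0 from above and from below.\<close>
  from this[of "?c + v"] this[of "?c - v"] show ?thesis
    using L v closest_point_subspace_in[OF L, of x] by (auto simp: subspace_add subspace_diff)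
qed

lemma closest_point_subspace_unique:
  fixes L :: "'a::euclidean_space set"
  assumes L: "subspace L" and w: "w \<in> L" and orth: "\<And>v. v \<in> L \<Longrightarrow> (x - w) \<bullet> v = 0"
  shows "closest_point L x = w"
proof -
  let ?d = "closest_point L x - w"
  have "?d \<in> L" using L w by (simp add: closest_point_subspace_in subspace_diff)
  then have "?d \<bullet> ?d = 0"
    using orth[of ?d] closest_point_subspace_orthogonal[OF L, of ?d x] by (simp add: inner_diff_left)
  then show ?thesis by simp
qed

lemma linear_closest_point_subspace:
  fixes L :: "'a::euclidean_space set"
  assumes L: "subspace L"
  shows "linear (closest_point L)"
proof (rule linearI)
  note [simp] = closest_point_subspace_in[OF L] closest_point_subspace_orthogonal[OF L]
  fix x y :: 'a and c :: real
  show "closest_point L (x + y) = closest_point L x + closest_point L y"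
  proof (rule closest_point_subspace_unique[OF L])
    fix v assume "v \<in> L"
    then have "(x - closest_point L x) \<bullet> v + (y - closest_point L y) \<bullet> v = 0" by simp
    then show "(x + y - (closest_point L x + closest_point L y)) \<bullet> v = 0"
      by (simp add: inner_diff_left inner_add_left)
  qed (use L in \<open>simp add: subspace_add\<close>)
  show "closest_point L (c *\<^sub>R x) = c *\<^sub>R closest_point L x"
  proof (rule closest_point_subspace_unique[OF L])
    fix v assume "v \<in> L"
    then show "(c *\<^sub>R x - c *\<^sub>R closest_point L x) \<bullet> v = 0"
      by (simp flip: scaleR_diff_right)
  qed (use L in \<open>simp add: subspace_scale\<close>)
qed

lemma closest_point_subspace_id:
  "subspace L \<Longrightarrow> closest_point L x = x \<longleftrightarrow> x \<in> (L :: 'a::euclidean_space set)"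
  by (metis closed_subspace closest_point_self closest_point_subspace_in)

lemma bounded_linear_closest_point_diff:
  fixes T T' :: "'a::euclidean_space set"
  assumes "subspace T" "subspace T'"
  shows "bounded_linear (\<lambda>v. closest_point T v - closest_point T' v)"
  using assms by (simp add: linear_closest_point_subspace linear_compose_sub linear_linear)

section \<open>Affine planes: smoothness, tangents, graph coordinates, density\<close>

lemma translate_subspace_eq:
  assumes "subspace L" "x \<in> (+) p ` L"
  shows "(+) p ` L = (+) x ` L"
proof -
  obtain l where l: "l \<in> L" "x = p + l" using assms(2) by auto
  have "p + y \<in> (+) x ` L" if "y \<in> L" for y
    using l that assms(1) by (intro image_eqI[of _ _ "y - l"]) (auto simp: subspace_diff)
  moreover have "x + y \<in> (+) p ` L" if "y \<in> L" for y
    using l that assms(1) by (intro image_eqI[of _ _ "l + y"]) (auto simp: subspace_add)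
  ultimately show ?thesis by blast
qed

lemma C1_smooth_at_translate_subspace:
  fixes L :: "'a::euclidean_space set"
  assumes "subspace L" "X = (+) p ` L"
  shows "C1_smooth_at X p"
proof -
  have "C1_submanifold (dim L) X"
    unfolding C1_submanifold_def
  proof
    fix x assume x: "x \<in> X"
    show "\<exists>U V \<phi> \<psi> L'. x \<in> U \<and> homeomorphism U V \<phi> \<psi> \<and> C1_on \<phi> U \<and> C1_on \<psi> V
       \<and> subspace (L' :: 'a set) \<and> dim L' = dim L \<and> \<phi> ` (X \<inter> U) = L' \<inter> V"
    proof (rule exI[of _ UNIV], rule exI[of _ UNIV], rule exI[of _ "\<lambda>y. y - x"], rule exI[of _ "\<lambda>y. y + x"],
        rule exI[of _ L], intro conjI)
      show "homeomorphism UNIV UNIV (\<lambda>y. y - x) (\<lambda>y. y + x)"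
        by (auto simp: homeomorphism_def image_iff intro!: continuous_intros)
      show "C1_on (\<lambda>y. y - x) UNIV" "C1_on (\<lambda>y. y + x) UNIV"
        unfolding C1_on_def has_C1_derivative_on_def
        by (auto intro!: exI[of _ "\<lambda>_. id_blinfun"] derivative_eq_intros)
      have "X = (+) x ` L"
        using translate_subspace_eq assms x by metis
      then show "(\<lambda>y. y - x) ` (X \<inter> UNIV) = L \<inter> UNIV"
        by (auto simp: image_iff)
    qed (use assms in auto)
  qed
  then show ?thesis
    unfolding C1_smooth_at_def by (intro exI[of _ UNIV] exI[of _ "dim L"]) auto
qed

lemma tangent_space_translate_subspace:
  fixes L :: "'a::euclidean_space set"
  assumes L: "subspace L" and X: "X = (+) x ` L"
  shows "tangent_space X x = L"
proof
  show "tangent_space X x \<subseteq> L"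
  proof
    fix v assume "v \<in> tangent_space X x"
    then obtain \<gamma> \<epsilon> where \<gamma>: "0 < \<epsilon>" "\<gamma> ` {-\<epsilon><..<\<epsilon>} \<subseteq> X" "\<gamma> 0 = x" "(\<gamma> has_vector_derivative v) (at (0::real))"
      unfolding tangent_space_def by blast
    \<comment> \<open>The projection onto the orthogonal complement of \<open>L\<close> kills every
      displacement within \<open>X\<close>. Its composition with the curve is constantly 0, so it
      also kills the velocity.\<close>
    let ?q = "\<lambda>y. y - closest_point L y"
    have "bounded_linear ?q"
      using linear_closest_point_subspace[OF L] by (simp add: linear_compose_sub[OF linear_ident] linear_linear)
    then have "((\<lambda>t. ?q (\<gamma> t - x)) has_vector_derivative ?q v) (at 0)"
      by (rule bounded_linear.has_vector_derivative) (auto intro!: derivative_eq_intros \<gamma>)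
    moreover have "((\<lambda>t. ?q (\<gamma> t - x)) has_vector_derivative 0) (at 0)"
    proof (rule has_vector_derivative_transform_within_open)
      show "((\<lambda>t. 0) has_vector_derivative 0) (at 0)" by (rule has_vector_derivative_const)
      fix t assume "t \<in> {-\<epsilon><..<\<epsilon>}"
      then have "\<gamma> t \<in> (+) x ` L" using \<gamma>(2) X by blast
      then have "\<gamma> t - x \<in> L" by auto
      then show "0 = ?q (\<gamma> t - x)" using closest_point_subspace_id[OF L, of "\<gamma> t - x"] by simp
    qed (use \<gamma>(1) in auto)
    ultimately have "?q v = 0" by (rule vector_derivative_unique_at)
    then show "v \<in> L" using closest_point_subspace_id[OF L, of v] by simp
  qed
  show "L \<subseteq> tangent_space X x"
  proof
    fix v assume v: "v \<in> L"
    have "((\<lambda>t. x + t *\<^sub>R v) has_vector_derivative v) (at t)" for t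
      by (auto intro!: derivative_eq_intros)
    moreover from this have "(\<lambda>t. x + t *\<^sub>R v) C1_differentiable_on {-1<..<1}"
      unfolding C1_differentiable_on_def by (intro exI[of _ "\<lambda>_. v"]) auto
    ultimately show "v \<in> tangent_space X x"
      unfolding tangent_space_def using v L X
      by (intro CollectI exI[of _ "\<lambda>t. x + t *\<^sub>R v"] exI[of _ 1]) (auto simp: subspace_scale)
  qed
qed

lemma tangents_at_infinity_translate_subspace:
  fixes L :: "'a::euclidean_space set"
  assumes L: "subspace L" "L \<noteq> {0}" and X: "X = (+) p ` L"
  shows "tangents_at_infinity X = L"
proof -
  have xX: "X = (+) x ` L" if "x \<in> X" for x
    using translate_subspace_eq L X that by metis
  have "Sing1 X = {}"
    using C1_smooth_at_translate_subspace[OF L(1) xX] by (auto simp: Sing1_def)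
  have tan: "tangent_space X x = L" if "x \<in> X" for x
    using tangent_space_translate_subspace[OF L(1) xX[OF that]] .
  have "T = L" if T: "subspace T" and x: "\<And>j. x j \<in> X" and lim: "subspaces_tendsto (\<lambda>j. tangent_space X (x j)) T" for T x
  proof -
    let ?D = "\<lambda>v. closest_point L v - closest_point T v"
    have "(\<lambda>j::nat. onorm ?D) \<longlonglongrightarrow> 0"
      using lim x tan by (simp add: subspaces_tendsto_def)
    then have "onorm ?D = 0" by (simp add: LIMSEQ_const_iff)
    then have "?D v = 0" for v
      using onorm_eq_0[OF bounded_linear_closest_point_diff[OF L(1) T]] by auto
    then show "T = L"
      using closest_point_subspace_id[OF L(1)] closest_point_subspace_id[OF T] by (metis eq_iff_diff_eq_0 subsetI subset_antisym)
  qed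
  \<comment> \<open>A ray in a nonzero direction supplies points going to infinity. If
    \<open>L\<close> were \<open>{0}\<close>, then \<open>X\<close> would be a single point and the
    union of limits would be empty.\<close>
  moreover obtain v where v: "v \<in> L" "v \<noteq> 0" using L subspace_0 by blast
  let ?x = "\<lambda>j. p + real j *\<^sub>R v"
  have "?x j \<in> X" for j using v L X by (simp add: subspace_scale)
  moreover have "filterlim (\<lambda>j. norm (?x j)) at_top sequentially"
  proof (rule filterlim_at_top_mono)
    show "filterlim (\<lambda>j. - norm p + norm v * real j) at_top sequentially"
      using v by (intro filterlim_tendsto_add_at_top[OF tendsto_const]
          filterlim_tendsto_pos_mult_at_top[OF tendsto_const] filterlim_real_sequentially) auto
    show "\<forall>\<^sub>F j in sequentially. - norm p + norm v * real j \<le> norm (?x j)"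
    proof (rule always_eventually, rule allI)
      show "- norm p + norm v * real j \<le> norm (?x j)" for j
        using norm_diff_ineq[of "real j *\<^sub>R v" p] by (simp add: add.commute mult.commute)
    qed
  qed
  moreover have "subspaces_tendsto (\<lambda>j. tangent_space X (?x j)) L"
    using tan \<open>\<And>j. ?x j \<in> X\<close> by (simp add: subspaces_tendsto_def onorm_zero)
  ultimately show ?thesis
    unfolding tangents_at_infinity_def \<open>Sing1 X = {}\<close> using L(1) by fast
qed

text \<open>Splitting a vector into its components in \<open>L\<close> and in the orthogonal
  complement, and identifying these isometrically with the two factors, gives coordinates in which a
  translate of \<open>L\<close> is the graph of a constant. Both exceptional compact sets are
  empty.\<close>

lemma C1_graph_outside_compact_translate_subspace:
  fixes L :: "((real^'n::finite) \<times> (real^'k::finite)) set"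
  assumes L: "subspace L" "dim L = CARD('n)"
  shows "C1_graph_outside_compact ((+) p ` L)"
proof -
  let ?P = "closest_point L"
  let ?M = "{y. \<forall>x\<in>L. orthogonal x y}"
  have lin: "linear ?P" by (rule linear_closest_point_subspace[OF L(1)])
  have M: "subspace ?M" by (auto simp: subspace_def orthogonal_clauses)
  have "dim ?M + dim L = DIM((real^'n) \<times> (real^'k))"
    using dim_subspace_orthogonal_to_vectors[OF L(1) subspace_UNIV] by simp
  then have dimM: "dim ?M = CARD('k)" using L(2) by simp
  obtain f :: "_ \<Rightarrow> real^'n" where f: "linear f" "f ` L = UNIV" "\<And>x. x \<in> L \<Longrightarrow> norm (f x) = norm x"
    by (rule isometry_subspaces[OF L(1) subspace_UNIV[where 'a="real^'n"]]) (use L(2) in simp_all)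
  obtain g :: "_ \<Rightarrow> real^'k" where g: "linear g" "g ` ?M = UNIV" "\<And>x. x \<in> ?M \<Longrightarrow> norm (g x) = norm x"
    by (rule isometry_subspaces[OF M subspace_UNIV[where 'a="real^'k"]]) (use dimM in simp_all)
  define A where "A z = (f (?P z), g (z - ?P z))" for z
  have PM: "z - ?P z \<in> ?M" for z
    using closest_point_subspace_orthogonal[OF L(1)] by (simp add: orthogonal_def inner_commute)
  have PL: "?P z \<in> L" for z by (rule closest_point_subspace_in[OF L(1)])
  have "linear A"
    using f(1) g(1) lin by (intro linearI) (simp_all add: A_def linear_add linear_diff linear_scale algebra_simps)
  moreover have "norm (A z) = norm z" for z
  proof -
    have "orthogonal (?P z) (z - ?P z)" using PM PL by simp
    then have "(norm (?P z + (z - ?P z)))\<^sup>2 = (norm (?P z))\<^sup>2 + (norm (z - ?P z))\<^sup>2"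
      by (rule norm_add_Pythagorean)
    then show ?thesis
      using f(3)[OF PL] g(3)[OF PM] by (simp add: A_def norm_Pair real_sqrt_unique)
  qed
  ultimately have A: "orthogonal_transformation A" by (simp add: orthogonal_transformation)
  let ?c = "g (p - ?P p)"
  have Apl: "A (p + l) = (f (?P p) + f l, ?c)" if "l \<in> L" for l
  proof -
    have "?P (p + l) = ?P p + l"
      using that closest_point_subspace_id[OF L(1), of l] by (simp add: linear_add[OF lin])
    then show ?thesis by (simp add: A_def linear_add[OF f(1)])
  qed
  have "A ` ((+) p ` L - {}) = {(x, ?c) |x. x \<in> - {}}"
  proof -
    have "(x, ?c) \<in> A ` ((+) p ` L)" for x
    proof -
      obtain l where "l \<in> L" "f l = x - f (?P p)" using f(2) by (metis UNIV_I imageE)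
      then show ?thesis using Apl[of l] by (intro image_eqI[of _ A "p + l"]) auto
    qed
    moreover have "A ` ((+) p ` L) \<subseteq> {(x, ?c) |x. True}"
      using Apl by (auto simp: image_image)
    ultimately show ?thesis by blast
  qed
  moreover have "has_C1_derivative_on (\<lambda>_::real^'n. ?c) (\<lambda>_. 0) (- {})"
    by (simp add: has_C1_derivative_on_def zero_blinfun.rep_eq)
  ultimately show ?thesis
    unfolding C1_graph_outside_compact_def using A
    by (intro exI[of _ A] exI[of _ "{}"] exI[of _ "\<lambda>_. ?c"] exI[of _ "\<lambda>_. 0"]) (auto simp: image_constant_conv)
qed

text \<open>The ratio is constantly 1, so both equivalences of the formula hold with all their sides
  true.\<close>

lemma satisfies_monotonicity_formula_translate_subspace:
  fixes L :: "'a::euclidean_space set"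
  assumes L: "subspace L" "dim L = CARD('n::finite)" and X: "X = (+) p ` L"
  shows "satisfies_monotonicity_formula CARD('n) X p"
proof -
  obtain f :: "real^'n \<Rightarrow> 'a" where f: "linear f" "f ` UNIV = L" "\<And>x. norm (f x) = norm x"
    by (rule isometry_subspaces[OF subspace_UNIV[where 'a="real^'n"] L(1)]) (use L(2) in simp_all)
  let ?J = "\<lambda>x. p + f x"
  have "X = range ?J" using X f(2) by auto
  moreover have "dist (?J x) (?J y) = dist x y" for x y
    using f by (simp add: dist_norm flip: linear_diff)
  moreover have pX: "p \<in> X" using X subspace_0[OF L(1)] by force
  ultimately have dens: "density_ratio CARD('n) X p r = 1" if "0 < r" for r
    using density_ratio_isometric_range[of ?J p r] that by simp
  have "cone_with_vertex p X"
    using X L(1) by (auto simp: cone_with_vertex_def cone_def image_image subspace_scale)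
  moreover have "density_ratio CARD('n) X p constant_on {0<..}"
    using dens by (auto simp: constant_on_def)
  moreover have "(density_ratio CARD('n) X p \<longlongrightarrow> 1) (at_right 0)"
    by (rule tendsto_eventually) (auto simp: eventually_at_right_field dens intro: exI[of _ 1])
  ultimately show ?thesis
    unfolding satisfies_monotonicity_formula_def
    using pX dens C1_smooth_at_translate_subspace[OF L(1) X] by (auto simp: mono_on_def)
qed

section \<open>Graphs with bounded derivative near infinity\<close>

text \<open>With \<open>P\<close> and \<open>P'\<close> the two projections,
  \<open>P - P' = P (1 - P') - (1 - P) P'\<close>. Each one-sided gap controls one of the two terms
  by \<open>e\<close>.\<close>

lemma onorm_closest_point_diff_le:
  fixes T T' :: "'a::euclidean_space set"
  assumes T: "subspace T" and T': "subspace T'" and "0 \<le> e"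
    and gap: "\<And>v. v \<in> T \<Longrightarrow> \<exists>w\<in>T'. norm (v - w) \<le> e * norm v"
      "\<And>v. v \<in> T' \<Longrightarrow> \<exists>w\<in>T. norm (v - w) \<le> e * norm v"
  shows "onorm (\<lambda>v. closest_point T v - closest_point T' v) \<le> 2 * e"
proof (rule onorm_le)
  fix x
  let ?P = "closest_point T" and ?P' = "closest_point T'"
  let ?y = "?P (x - ?P' x)"
  have y: "?y \<in> T" and x': "?P' x \<in> T'"
    by (rule closest_point_subspace_in T T')+
  have nx: "norm (x - ?P' x) \<le> norm x"
    using closest_point_le[OF closed_subspace[OF T'] subspace_0[OF T'], of x] by (simp add: dist_norm)
  have nP': "norm (?P' x) \<le> norm x"
  proof -
    have "?P' x \<bullet> ?P' x = x \<bullet> ?P' x"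
      using closest_point_subspace_orthogonal[OF T' x', of x] by (simp add: inner_diff_left)
    also have "\<dots> \<le> norm x * norm (?P' x)" by (rule norm_cauchy_schwarz)
    finally show ?thesis by (cases "?P' x = 0") (auto simp: power2_norm_eq_inner[symmetric] power2_eq_square)
  qed
  obtain w where w: "w \<in> T'" "norm (?y - w) \<le> e * norm ?y" using gap(1)[OF y] by blast
  have "?y \<bullet> ?y = (x - ?P' x) \<bullet> ?y"
    using closest_point_subspace_orthogonal[OF T y, of "x - ?P' x"] by (simp add: inner_diff_left)
  \<comment> \<open>Since \<open>x - ?P' x\<close> is orthogonal to \<open>T'\<close>, the
    approximation \<open>w\<close> of \<open>?y\<close> in \<open>T'\<close> can be subtracted for
    free, which produces the small factor.\<close>
  also have "\<dots> = (x - ?P' x) \<bullet> (?y - w)"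
    using closest_point_subspace_orthogonal[OF T' w(1), of x] by (simp add: inner_diff_right)
  also have "\<dots> \<le> norm (x - ?P' x) * norm (?y - w)" by (rule norm_cauchy_schwarz)
  also have "\<dots> \<le> norm x * (e * norm ?y)" using nx w(2) by (intro mult_mono) auto
  finally have "norm ?y * norm ?y \<le> (e * norm x) * norm ?y"
    by (simp add: power2_norm_eq_inner[symmetric] power2_eq_square mult_ac)
  then have 1: "norm ?y \<le> e * norm x"
    using \<open>0 \<le> e\<close> by (cases "?y = 0") auto
  obtain w where w: "w \<in> T" "norm (?P' x - w) \<le> e * norm (?P' x)" using gap(2)[OF x'] by blast
  have "norm (?P' x - ?P (?P' x)) \<le> norm (?P' x - w)"
    using closest_point_le[OF closed_subspace[OF T] w(1), of "?P' x"] by (simp add: dist_norm)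
  also have "\<dots> \<le> e * norm x" using w(2) mult_left_mono[OF nP' \<open>0 \<le> e\<close>] by linarith
  finally have 2: "norm (?P' x - ?P (?P' x)) \<le> e * norm x" .
  have "?P x - ?P' x = ?y - (?P' x - ?P (?P' x))"
    using linear_closest_point_subspace[OF T] by (simp add: linear_diff)
  then have "norm (?P x - ?P' x) \<le> norm ?y + norm (?P' x - ?P (?P' x))"
    by (metis norm_triangle_ineq4)
  with 1 2 show "norm (?P x - ?P' x) \<le> 2 * e * norm x" by simp
qed

lemma C1_on_imp_continuous_on: "C1_on f U \<Longrightarrow> continuous_on U f"
  unfolding C1_on_def has_C1_derivative_on_def
  by (meson has_derivative_at_withinI has_derivative_continuous_on)

locale C1_graph_end =
  fixes X :: "((real^'n::finite) \<times> (real^'k::finite)) set"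
    and A :: "(real^'n) \<times> (real^'k) \<Rightarrow> (real^'n) \<times> (real^'k)"
    and K :: "(real^'n) set" and K' :: "((real^'n) \<times> (real^'k)) set"
    and u :: "real^'n \<Rightarrow> real^'k" and u' :: "real^'n \<Rightarrow> ((real^'n) \<Rightarrow>\<^sub>L (real^'k))"
  assumes A: "orthogonal_transformation A"
    and K: "compact K" and K': "compact K'"
    and C1: "has_C1_derivative_on u u' (- K)"
    and bounded_deriv: "bounded (u' ` (- K))"
    and graph: "A ` (X - K') = {(x, u x) |x. x \<in> - K}"
begin

text \<open>\<open>tangents_at_infinity\<close> and the density ratio refer to \<open>X\<close>
  itself and not to its rotated copy. The graph and the graphs of linear maps are therefore carried
  back to the original space by \<open>B\<close>.\<close>

definition B where "B = inv A"
definition G where "G x = B (x, u x)"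
definition plane :: "(((real^'n) \<Rightarrow>\<^sub>L (real^'k))) \<Rightarrow> ((real^'n) \<times> (real^'k)) set" where
  "plane \<Lambda> = range (\<lambda>v. B (v, blinfun_apply \<Lambda> v))"

lemma B: "orthogonal_transformation B"
  unfolding B_def using A by (rule orthogonal_transformation_inv)

lemma linear_A: "linear A" and linear_B: "linear B"
  using A B by (auto simp: orthogonal_transformation)

lemma AB [simp]: "A (B z) = z" and BA [simp]: "B (A z) = z"
  unfolding B_def using orthogonal_transformation_bij[OF A]
  by (simp_all add: bij_is_surj bij_is_inj surj_f_inv_f inv_f_f)

lemma norm_B [simp]: "norm (B z) = norm z"
  using B unfolding orthogonal_transformation by blast

lemma B_0 [simp]: "B 0 = 0" by (rule linear_0[OF linear_B])

lemma B_pair_diff: "B (a, b) - B (c, d) = B (a - c, b - d)"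
  by (simp flip: linear_diff[OF linear_B])

lemma bounded_linear_A: "bounded_linear A" and bounded_linear_B: "bounded_linear B"
  using linear_A linear_B by (simp_all add: linear_linear)

lemma end_eq: "X - K' = G ` (- K)"
proof -
  have "X - K' = B ` (A ` (X - K'))" by (simp add: image_image)
  then show ?thesis unfolding graph by (auto simp: G_def)
qed

lemma u_deriv: "x \<notin> K \<Longrightarrow> (u has_derivative blinfun_apply (u' x)) (at x)"
  and u'_cont: "continuous_on (- K) u'" and open_Compl_K: "open (- K)"
  using C1 by (auto simp: has_C1_derivative_on_def)

section \<open>Charts and tangent spaces along the graph\<close>

lemma norm_G: "norm x \<le> norm (G x)"
  by (simp add: G_def norm_Pair)

text \<open>The shear that subtracts \<open>(0, u x)\<close> at parameter \<open>x\<close> flattens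
  the graph. It is defined on the whole cylinder over \<open>- K\<close>, so a single chart serves
  all of \<open>X - K'\<close>.\<close>

lemma smooth_at_G:
  assumes x: "x \<notin> K" shows "C1_smooth_at X (G x)"
proof -
  let ?S = "X \<inter> - K'" and ?U = "{z. fst (A z) \<in> - K}" and ?V = "{z::(real^'n) \<times> (real^'k). fst z \<in> - K}"
  let ?L = "{z::(real^'n) \<times> (real^'k). snd z = 0}"
  let ?\<phi> = "\<lambda>z. A z - (0, u (fst (A z)))" and ?\<psi> = "\<lambda>z. B (z + (0, u (fst z)))"
  \<comment> \<open>Bounded-linear versions of \<open>A\<close>, \<open>B\<close>, the first
    projection and the second inclusion. The derivatives of the charts become compositions with
    \<open>u'\<close> and inherit its continuity.\<close>
  define a b f i where "a = Blinfun A" "b = Blinfun B" "f = Blinfun (fst :: (real^'n) \<times> (real^'k) \<Rightarrow> _)"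
    "i = Blinfun (\<lambda>y. (0::real^'n, y::real^'k))"
  have bl_i: "bounded_linear (\<lambda>y. (0::real^'n, y::real^'k))"
    by (intro bounded_linear_Pair bounded_linear_zero bounded_linear_ident)
  have [simp]: "blinfun_apply a = A" "blinfun_apply b = B" "blinfun_apply f = fst" "blinfun_apply i = (\<lambda>y. (0, y))"
    using bounded_linear_A bounded_linear_B bl_i by (simp_all add: a_b_f_i_def bounded_linear_Blinfun_apply bounded_linear_fst)
  have S: "?S = G ` (- K)" using end_eq by auto
  have cA: "continuous_on T A" and cB: "continuous_on T B" for T
    using bounded_linear_A bounded_linear_B by (auto intro: linear_continuous_on)
  have uA: "((\<lambda>z. u (fst (A z))) has_derivative (\<lambda>h. u' (fst (A z)) (fst (A h)))) (at z)" if "z \<in> ?U" for z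
    by (rule has_derivative_compose[where f="\<lambda>z. fst (A z)"])
      (use that u_deriv bounded_linear_A in \<open>auto intro!: derivative_eq_intros bounded_linear.has_derivative[of A]\<close>)
  have u1: "((\<lambda>z. u (fst z)) has_derivative (\<lambda>h. u' (fst z) (fst h))) (at z)" if "z \<in> ?V" for z :: "(real^'n) \<times> (real^'k)"
    by (rule has_derivative_compose[where f=fst]) (use that u_deriv in \<open>auto intro!: derivative_eq_intros\<close>)
  have open_U: "open ?U" and open_V: "open ?V"
    using open_vimage[OF open_Compl_K, of "\<lambda>z. fst (A z)"] open_vimage[OF open_Compl_K, of fst] cA
    by (auto simp: vimage_def continuous_on_fst)
  have C1_\<phi>: "C1_on ?\<phi> ?U"
    unfolding C1_on_def has_C1_derivative_on_def
  proof (intro exI conjI ballI)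
    show "open ?U" by (rule open_U)
    show "continuous_on ?U (\<lambda>z. a - ((i o\<^sub>L u' (fst (A z))) o\<^sub>L (f o\<^sub>L a)))"
      by (intro continuous_intros continuous_on_compose2[OF u'_cont] cA) auto
    fix z assume "z \<in> ?U"
    then show "(?\<phi> has_derivative blinfun_apply (a - ((i o\<^sub>L u' (fst (A z))) o\<^sub>L (f o\<^sub>L a)))) (at z)"
      using uA[of z] bounded_linear_A
      by (auto intro!: derivative_eq_intros bounded_linear.has_derivative[of A] simp: blinfun.diff_left)
  qed
  have C1_\<psi>: "C1_on ?\<psi> ?V"
    unfolding C1_on_def has_C1_derivative_on_def
  proof (intro exI conjI ballI)
    show "open ?V" by (rule open_V)
    show "continuous_on ?V (\<lambda>z. b o\<^sub>L (id_blinfun + ((i o\<^sub>L u' (fst z)) o\<^sub>L f)))"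
      by (intro continuous_intros continuous_on_compose2[OF u'_cont]) auto
    fix z :: "(real^'n) \<times> (real^'k)" assume "z \<in> ?V"
    then show "(?\<psi> has_derivative blinfun_apply (b o\<^sub>L (id_blinfun + ((i o\<^sub>L u' (fst z)) o\<^sub>L f)))) (at z)"
    proof -
      have "((\<lambda>z. z + (0, u (fst z))) has_derivative (\<lambda>h. h + (0, u' (fst z) (fst h)))) (at z)"
        using u1[OF \<open>z \<in> ?V\<close>] by (auto intro!: derivative_eq_intros)
      moreover have "blinfun_apply (b o\<^sub>L (id_blinfun + ((i o\<^sub>L u' (fst z)) o\<^sub>L f))) = (\<lambda>h. B (h + (0, u' (fst z) (fst h))))"
        by (simp add: fun_eq_iff blinfun.add_left)
      ultimately show ?thesis
        by (simp only: bounded_linear.has_derivative[OF bounded_linear_B])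
    qed
  qed
  have homeo: "homeomorphism ?U ?V ?\<phi> ?\<psi>"
  proof -
    have "continuous_on ?U ?\<phi>" "continuous_on ?V ?\<psi>"
      by (intro C1_on_imp_continuous_on C1_\<phi> C1_\<psi>)+
    then show ?thesis
      by (rule homeomorphismI) (simp_all add: image_subset_iff del: split_paired_All)
  qed
  have image: "?\<phi> ` (?S \<inter> ?U) = ?L \<inter> ?V"
  proof -
    have "?S \<inter> ?U = ?S" unfolding S by (auto simp: G_def)
    then show ?thesis unfolding S by (force simp: G_def image_image)
  qed
  have subspace_L: "subspace ?L" by (auto simp: subspace_def)
  have S_U: "?S \<subseteq> ?U" unfolding S by (auto simp: G_def)
  have "C1_submanifold (dim ?L) ?S"
    unfolding C1_submanifold_def
    by (intro ballI, rule exI[of _ ?U], rule exI[of _ ?V], rule exI[of _ ?\<phi>], rule exI[of _ ?\<psi>], rule exI[of _ ?L])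
      (intro conjI subsetD[OF S_U] homeo C1_\<phi> C1_\<psi> subspace_L image refl)
  moreover have "open (- K')" using K' by (simp add: compact_imp_closed open_Compl)
  moreover have "G x \<in> - K'" using end_eq x by blast
  ultimately show ?thesis unfolding C1_smooth_at_def by blast
qed

lemma u_path_deriv:
  assumes "x + t *\<^sub>R v \<notin> K"
  shows "((\<lambda>t. u (x + t *\<^sub>R v)) has_vector_derivative u' (x + t *\<^sub>R v) v) (at t)"
proof -
  have "((\<lambda>t. u (x + t *\<^sub>R v)) has_derivative (\<lambda>h. u' (x + t *\<^sub>R v) (h *\<^sub>R v))) (at t)"
    by (rule has_derivative_compose[where f="\<lambda>t. x + t *\<^sub>R v"])
      (use u_deriv[OF assms] in \<open>auto intro!: derivative_eq_intros\<close>)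
  then show ?thesis by (simp add: has_vector_derivative_def blinfun.scaleR_right)
qed

text \<open>Differentiating the graph equation along a curve forces its velocity to be the graph
  vector of \<open>u' x\<close> over the velocity of the parameter. Conversely, lifting a straight
  line of parameters to the graph realises every such vector.\<close>

lemma tangent_space_G:
  assumes x: "x \<notin> K" shows "tangent_space X (G x) = plane (u' x)"
proof
  show "tangent_space X (G x) \<subseteq> plane (u' x)"
  proof
    fix v assume "v \<in> tangent_space X (G x)"
    then obtain \<gamma> \<epsilon> where \<gamma>: "0 < \<epsilon>" "\<gamma> ` {-\<epsilon><..<\<epsilon>} \<subseteq> X" "\<gamma> 0 = G x" "(\<gamma> has_vector_derivative v) (at (0::real))"
      "\<gamma> C1_differentiable_on {-\<epsilon><..<\<epsilon>}"
      unfolding tangent_space_def by blast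
    have "continuous_on {-\<epsilon><..<\<epsilon>} \<gamma>" by (rule C1_differentiable_imp_continuous_on[OF \<gamma>(5)])
    moreover have "open (- K')" using K' by (simp add: compact_imp_closed open_Compl)
    \<comment> \<open>The curve is only known to stay in \<open>X\<close>. Near time 0 it also
      avoids the closed set \<open>K'\<close>, and there the graph equation is available.\<close>
    ultimately have "open (\<gamma> -` (- K') \<inter> {-\<epsilon><..<\<epsilon>})" by (metis continuous_on_open_vimage open_greaterThanLessThan)
    moreover have "0 \<in> \<gamma> -` (- K') \<inter> {-\<epsilon><..<\<epsilon>}" using \<gamma>(1,3) end_eq x by auto
    ultimately have nbhd: "open (\<gamma> -` (- K') \<inter> {-\<epsilon><..<\<epsilon>})" "0 \<in> \<gamma> -` (- K') \<inter> {-\<epsilon><..<\<epsilon>}" by auto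
    have on_graph: "snd (A (\<gamma> t)) = u (fst (A (\<gamma> t)))" if "t \<in> \<gamma> -` (- K') \<inter> {-\<epsilon><..<\<epsilon>}" for t
    proof -
      have "\<gamma> t \<in> X - K'" using that \<gamma>(2) by auto
      then show ?thesis unfolding end_eq by (auto simp: G_def)
    qed
    have Ad: "((\<lambda>t. A (\<gamma> t)) has_vector_derivative A v) (at 0)"
      by (rule bounded_linear.has_vector_derivative[OF bounded_linear_A \<gamma>(4)])
    have fstd: "((\<lambda>t. fst (A (\<gamma> t))) has_vector_derivative fst (A v)) (at 0)"
      by (rule bounded_linear.has_vector_derivative[OF bounded_linear_fst Ad])
    have sndd: "((\<lambda>t. snd (A (\<gamma> t))) has_vector_derivative snd (A v)) (at 0)"
      by (rule bounded_linear.has_vector_derivative[OF bounded_linear_snd Ad])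
    have "((\<lambda>t. u (fst (A (\<gamma> t)))) has_derivative (\<lambda>h. u' x (h *\<^sub>R fst (A v)))) (at 0)"
      by (rule has_derivative_compose[where f="\<lambda>t. fst (A (\<gamma> t))"])
        (use fstd u_deriv[OF x] \<gamma>(3) in \<open>auto simp: has_vector_derivative_def G_def\<close>)
    then have "((\<lambda>t. u (fst (A (\<gamma> t)))) has_vector_derivative u' x (fst (A v))) (at 0)"
      by (simp add: has_vector_derivative_def blinfun.scaleR_right)
    then have "((\<lambda>t. snd (A (\<gamma> t))) has_vector_derivative u' x (fst (A v))) (at 0)"
      by (rule has_vector_derivative_transform_within_open[OF _ nbhd]) (simp add: on_graph)
    with sndd have "snd (A v) = u' x (fst (A v))" by (rule vector_derivative_unique_at)
    then have "v = B (fst (A v), u' x (fst (A v)))" by (metis BA prod.collapse)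
    then show "v \<in> plane (u' x)" unfolding plane_def by blast
  qed
  show "plane (u' x) \<subseteq> tangent_space X (G x)"
  proof
    fix z assume "z \<in> plane (u' x)"
    then obtain v where z: "z = B (v, u' x v)" unfolding plane_def by auto
    have "open ((\<lambda>t. x + t *\<^sub>R v) -` (- K))"
      by (intro open_vimage open_Compl_K continuous_intros)
    moreover have "0 \<in> (\<lambda>t. x + t *\<^sub>R v) -` (- K)" using x by simp
    ultimately obtain \<epsilon> where \<epsilon>: "0 < \<epsilon>" "ball 0 \<epsilon> \<subseteq> (\<lambda>t. x + t *\<^sub>R v) -` (- K)"
      using open_contains_ball by blast
    have nK: "x + t *\<^sub>R v \<notin> K" if "t \<in> {-\<epsilon><..<\<epsilon>}" for t
      using that \<epsilon>(2) by (auto simp: subset_iff)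
    let ?\<gamma> = "\<lambda>t. G (x + t *\<^sub>R v)"
    have d: "(?\<gamma> has_vector_derivative B (v, u' (x + t *\<^sub>R v) v)) (at t)" if "t \<in> {-\<epsilon><..<\<epsilon>}" for t
      unfolding G_def
      by (rule bounded_linear.has_vector_derivative[OF bounded_linear_B])
        (auto intro!: derivative_eq_intros has_vector_derivative_Pair u_path_deriv nK that)
    have "?\<gamma> C1_differentiable_on {-\<epsilon><..<\<epsilon>}"
      unfolding C1_differentiable_on_def
    proof (intro exI conjI ballI)
      show "continuous_on {-\<epsilon><..<\<epsilon>} (\<lambda>t. B (v, u' (x + t *\<^sub>R v) v))"
        by (intro continuous_on_compose2[OF linear_continuous_on[OF bounded_linear_B, of UNIV]] continuous_intros
            continuous_on_compose2[OF u'_cont]) (use nK in auto)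
    qed (rule d)
    moreover have "?\<gamma> ` {-\<epsilon><..<\<epsilon>} \<subseteq> X" using nK end_eq by blast
    ultimately show "z \<in> tangent_space X (G x)"
      unfolding tangent_space_def z using \<epsilon>(1) d[of 0] by (intro CollectI exI[of _ ?\<gamma>] exI[of _ \<epsilon>]) auto
  qed
qed

section \<open>Limits of tangent planes at infinity\<close>

lemma subspace_plane: "subspace (plane \<Lambda>)"
proof -
  have "linear (\<lambda>v. B (v, blinfun_apply \<Lambda> v))"
    by (rule linearI) (simp_all add: blinfun.add_right blinfun.scaleR_right flip: linear_add[OF linear_B] linear_scale[OF linear_B])
  then show ?thesis unfolding plane_def by (rule linear_subspace_image) simp
qed

text \<open>Graph vectors of two linear maps over the same parameter differ by the difference of the
  maps at that parameter, and a graph vector is at least as long as its parameter. Hence both gaps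
  between the planes are at most the norm of the difference of the maps.\<close>

lemma subspaces_tendsto_plane:
  assumes "\<Lambda> \<longlonglongrightarrow> \<Lambda>0"
  shows "subspaces_tendsto (\<lambda>j. plane (\<Lambda> j)) (plane \<Lambda>0)"
  unfolding subspaces_tendsto_def
proof (rule tendsto_sandwich[where f="\<lambda>_. 0" and h="\<lambda>j. 2 * norm (\<Lambda> j - \<Lambda>0)"])
  have gap: "\<exists>w\<in>plane \<Lambda>2. norm (v - w) \<le> norm (\<Lambda>1 - \<Lambda>2) * norm v" if "v \<in> plane \<Lambda>1" for v \<Lambda>1 \<Lambda>2
  proof -
    obtain a where a: "v = B (a, \<Lambda>1 a)" using \<open>v \<in> plane \<Lambda>1\<close> unfolding plane_def by blast
    have "norm (v - B (a, \<Lambda>2 a)) = norm ((\<Lambda>1 - \<Lambda>2) a)"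
      by (simp add: a B_pair_diff norm_Pair blinfun.diff_left)
    also have "\<dots> \<le> norm (\<Lambda>1 - \<Lambda>2) * norm a" by (rule norm_blinfun)
    also have "\<dots> \<le> norm (\<Lambda>1 - \<Lambda>2) * norm v" by (intro mult_left_mono) (simp_all add: a norm_Pair)
    finally show ?thesis unfolding plane_def by blast
  qed
  show "\<forall>\<^sub>F j in sequentially. onorm (\<lambda>v. closest_point (plane (\<Lambda> j)) v - closest_point (plane \<Lambda>0) v) \<le> 2 * norm (\<Lambda> j - \<Lambda>0)"
    by (intro always_eventually allI onorm_closest_point_diff_le subspace_plane gap) (auto simp: norm_minus_commute intro: gap)
  show "(\<lambda>j. 2 * norm (\<Lambda> j - \<Lambda>0)) \<longlonglongrightarrow> 0"
    using assms by (intro tendsto_mult_right_zero tendsto_norm_zero) (simp add: LIM_zero_iff)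
  show "\<forall>\<^sub>F j in sequentially. 0 \<le> onorm (\<lambda>v. closest_point (plane (\<Lambda> j)) v - closest_point (plane \<Lambda>0) v)"
    by (intro always_eventually allI onorm_pos_le bounded_linear_closest_point_diff subspace_plane)
qed simp

lemma plane_subset_tangents_at_infinity:
  assumes x: "\<And>j. x j \<notin> K" "filterlim (\<lambda>j. norm (x j)) at_top sequentially" "(\<lambda>j. u' (x j)) \<longlonglongrightarrow> \<Lambda>"
  shows "plane \<Lambda> \<subseteq> tangents_at_infinity X"
proof -
  have "G (x j) \<in> X - Sing1 X" for j
    using smooth_at_G[OF x(1)] end_eq x(1) by (auto simp: Sing1_def)
  moreover have "filterlim (\<lambda>j. norm (G (x j))) at_top sequentially"
    by (rule filterlim_at_top_mono[OF x(2)]) (simp add: norm_G)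
  moreover have "subspaces_tendsto (\<lambda>j. tangent_space X (G (x j))) (plane \<Lambda>)"
    using subspaces_tendsto_plane[OF x(3)] by (simp add: tangent_space_G x(1))
  ultimately show ?thesis
    unfolding tangents_at_infinity_def using subspace_plane by (intro Union_upper CollectI conjI exI[of _ "\<lambda>j. G (x j)"]) auto
qed

text \<open>Projecting \<open>B (0, w)\<close> onto the graph of a linear map of norm at most
  \<open>M\<close> moves it by at least \<open>norm w / (1 + M)\<close>. If \<open>B (0, w)\<close>
  lies in a limit of such planes, these displacements tend to 0.\<close>

lemma tangents_at_infinity_not_vertical:
  assumes "B (0, w) \<in> tangents_at_infinity X" shows "w = 0"
proof -
  obtain M where M: "\<And>x. x \<notin> K \<Longrightarrow> norm (u' x) \<le> M"
    using bounded_deriv by (auto simp: bounded_iff)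
  obtain T x where T: "subspace T" "B (0, w) \<in> T" and x: "\<And>j. x j \<in> X - Sing1 X"
      "filterlim (\<lambda>j. norm (x j)) at_top sequentially" and lim: "subspaces_tendsto (\<lambda>j. tangent_space X (x j)) T"
    using assms unfolding tangents_at_infinity_def by blast
  let ?z = "B (0, w)"
  let ?D = "\<lambda>j v. closest_point (tangent_space X (x j)) v - closest_point T v"
  obtain R where R: "\<And>z. z \<in> K' \<Longrightarrow> norm z \<le> R"
    using compact_imp_bounded[OF K'] by (auto simp: bounded_iff)
  have "\<forall>\<^sub>F j in sequentially. R < norm (x j)"
    using x(2) by (auto simp: filterlim_at_top_dense)
  then have "\<forall>\<^sub>F j in sequentially. norm w \<le> (1 + M) * (onorm (?D j) * norm ?z)"
  proof eventually_elim
    case (elim j)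
    \<comment> \<open>The sequence in the definition may start inside \<open>K'\<close>; only its
      far terms are known to lie on the graph.\<close>
    then have "x j \<in> X - K'" using x(1) R by (metis Diff_iff not_le)
    then obtain y where y: "y \<notin> K" "x j = G y" unfolding end_eq by auto
    have tan: "tangent_space X (x j) = plane (u' y)" by (simp add: y tangent_space_G)
    have "closest_point (plane (u' y)) ?z \<in> plane (u' y)"
      by (rule closest_point_subspace_in[OF subspace_plane])
    then obtain a where a: "closest_point (plane (u' y)) ?z = B (a, u' y a)" unfolding plane_def by auto
    have "closest_point T ?z = ?z" using closest_point_subspace_id[OF T(1)] T(2) by simp
    then have "?D j ?z = B (a, u' y a - w)" by (simp add: tan a B_pair_diff)
    then have "norm (a, u' y a - w) \<le> onorm (?D j) * norm ?z"
      using onorm[OF bounded_linear_closest_point_diff[OF _ T(1)], of "tangent_space X (x j)" ?z]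
      by (simp add: tan subspace_plane)
    then have *: "norm a \<le> onorm (?D j) * norm ?z" "norm (u' y a - w) \<le> onorm (?D j) * norm ?z"
      using norm_fst_le[of a "u' y a - w"] norm_snd_le[of "u' y a - w" a] by (blast intro: order_trans)+
    have "0 \<le> M" using M[OF y(1)] norm_ge_zero order_trans by blast
    have "norm w \<le> norm (u' y a - w) + norm (u' y a)"
      using norm_triangle_ineq4[of "u' y a" "u' y a - w"] by simp
    also have "norm (u' y a) \<le> M * norm a"
      using norm_blinfun[of "u' y" a] mult_right_mono[OF M[OF y(1)] norm_ge_zero[of a]] by linarith
    also have "M * norm a \<le> M * (onorm (?D j) * norm ?z)" using * \<open>0 \<le> M\<close> by (intro mult_left_mono) auto
    finally show ?case using * by (simp add: algebra_simps)
  qed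
  moreover have "(\<lambda>j. (1 + M) * (onorm (?D j) * norm ?z)) \<longlonglongrightarrow> 0"
    using lim unfolding subspaces_tendsto_def by (intro tendsto_mult_right_zero tendsto_mult_left_zero)
  ultimately have "norm w \<le> 0"
    by (intro tendsto_lowerbound[of _ 0 sequentially]) auto
  then show ?thesis by simp
qed

text \<open>The derivatives form a bounded set in a finite-dimensional space, so along any sequence
  escaping to infinity they accumulate, and each accumulation point contributes a plane.\<close>

lemma convergent_subseq_deriv:
  assumes "\<And>j::nat. x j \<notin> K" "filterlim (\<lambda>j. norm (x j)) at_top sequentially"
  obtains r \<Lambda> where "strict_mono r" "(\<lambda>j. u' (x (r j))) \<longlonglongrightarrow> \<Lambda>" "plane \<Lambda> \<subseteq> tangents_at_infinity X"
proof -
  have "bounded (range (\<lambda>j. u' (x j)))"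
    by (rule bounded_subset[OF bounded_deriv]) (use assms in auto)
  then obtain \<Lambda> r where r: "strict_mono r" "((\<lambda>j. u' (x j)) \<circ> r) \<longlonglongrightarrow> \<Lambda>"
    using bounded_imp_convergent_subsequence by blast
  have "plane \<Lambda> \<subseteq> tangents_at_infinity X"
  proof (rule plane_subset_tangents_at_infinity)
    show "filterlim (\<lambda>j. norm (x (r j))) at_top sequentially"
      using filterlim_compose[OF assms(2) filterlim_subseq[OF r(1)]] .
  qed (use assms r in \<open>auto simp: o_def\<close>)
  with r show ?thesis by (intro that) (auto simp: o_def)
qed

theorem deriv_tendsto_at_infinity:
  assumes N: "subspace (tangents_at_infinity X)"
  obtains \<Lambda> where "(u' \<longlongrightarrow> \<Lambda>) at_infinity"
proof -
  obtain R where R: "\<And>x. x \<in> K \<Longrightarrow> norm x \<le> R"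
    using compact_imp_bounded[OF K] by (auto simp: bounded_iff)
  have seq: "filterlim (\<lambda>j. norm (x j)) at_top sequentially" "x j \<notin> K"
    if "\<And>j::nat. R + 1 + real j \<le> norm (x j)" for x :: "nat \<Rightarrow> real^'n" and j
  proof -
    have "filterlim (\<lambda>j. R + 1 + real j) at_top sequentially"
      by (intro filterlim_tendsto_add_at_top[OF tendsto_const] filterlim_real_sequentially)
    then show "filterlim (\<lambda>j. norm (x j)) at_top sequentially"
      by (rule filterlim_at_top_mono) (simp add: that)
    show "x j \<notin> K" using that[of j] R[of "x j"] by auto
  qed
  \<comment> \<open>The absolute value keeps the prescribed norm nonnegative; for empty
    \<open>K\<close> the bound \<open>R\<close> could be negative.\<close>
  have "\<exists>x::real^'n. norm x = \<bar>R\<bar> + 1 + real j" for j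
    using vector_choose_size[of "\<bar>R\<bar> + 1 + real j"] by (metis abs_ge_zero add_nonneg_nonneg of_nat_0_le_iff zero_le_one)
  then obtain x :: "nat \<Rightarrow> real^'n" where x: "\<And>j. norm (x j) = \<bar>R\<bar> + 1 + real j" by metis
  obtain r \<Lambda> where \<Lambda>: "plane \<Lambda> \<subseteq> tangents_at_infinity X"
    by (rule convergent_subseq_deriv[of x]) (use seq[of x] x in auto)
  have "(u' \<longlongrightarrow> \<Lambda>) at_infinity"
  proof (rule ccontr)
    assume "\<not> ?thesis"
    then obtain e where e: "0 < e" "\<And>b. \<exists>x. b \<le> norm x \<and> e \<le> dist (u' x) \<Lambda>"
      unfolding tendsto_iff eventually_at_infinity by (metis not_le)
    then have "\<exists>x. R + 1 + real j \<le> norm x \<and> e \<le> dist (u' x) \<Lambda>" for j by blast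
    then obtain y where y: "\<And>j::nat. R + 1 + real j \<le> norm (y j) \<and> e \<le> dist (u' (y j)) \<Lambda>" by metis
    obtain s \<Lambda>' where \<Lambda>': "strict_mono s" "(\<lambda>j. u' (y (s j))) \<longlonglongrightarrow> \<Lambda>'" "plane \<Lambda>' \<subseteq> tangents_at_infinity X"
      by (rule convergent_subseq_deriv[of y]) (use seq[of y] y in auto)
    have "\<Lambda> v = \<Lambda>' v" for v
    proof -
      \<comment> \<open>Two graph vectors over the same parameter have a vertical difference, and it
        remains among the tangents at infinity because these form a subspace.\<close>
      have "B (v, \<Lambda> v) - B (v, \<Lambda>' v) \<in> tangents_at_infinity X"
        using \<Lambda> \<Lambda>'(3) by (intro subspace_diff[OF N]) (auto simp: plane_def)
      then have "\<Lambda> v - \<Lambda>' v = 0"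
        by (intro tangents_at_infinity_not_vertical) (simp add: B_pair_diff)
      then show ?thesis by simp
    qed
    then have "\<Lambda> = \<Lambda>'" by (rule blinfun_eqI)
    moreover have "e \<le> dist \<Lambda>' \<Lambda>"
      by (rule tendsto_lowerbound[OF tendsto_dist[OF \<Lambda>'(2) tendsto_const]]) (use y in auto)
    ultimately show False using e(1) by simp
  qed
  then show ?thesis by (rule that)
qed

section \<open>Growth of the graph and of its measure\<close>

lemma linear_part_diff_le:
  assumes "convex S" "S \<subseteq> - K" "\<And>z. z \<in> S \<Longrightarrow> norm (u' z - \<Lambda>) \<le> e" "x \<in> S" "y \<in> S"
  shows "norm ((u x - blinfun_apply \<Lambda> x) - (u y - blinfun_apply \<Lambda> y)) \<le> e * norm (x - y)"
proof (rule differentiable_bound[OF assms(1) _ _ assms(4,5)])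
  fix z assume z: "z \<in> S"
  then have "(u has_derivative blinfun_apply (u' z)) (at z)"
    using assms(2) by (intro u_deriv) auto
  then have "((\<lambda>x. u x - blinfun_apply \<Lambda> x) has_derivative blinfun_apply (u' z - \<Lambda>)) (at z)"
    by (auto intro!: derivative_eq_intros simp: blinfun.diff_left)
  then show "((\<lambda>x. u x - blinfun_apply \<Lambda> x) has_derivative blinfun_apply (u' z - \<Lambda>)) (at z within S)"
    by (rule has_derivative_at_withinI)
  show "onorm (blinfun_apply (u' z - \<Lambda>)) \<le> e"
    using assms(3)[OF z] by (simp add: norm_blinfun.rep_eq)
qed

lemma u_cont: "continuous_on (- K) u"
  using C1_on_imp_continuous_on C1 unfolding C1_on_def by blast

text \<open>The mean value inequality is applied only along the radial segment from the sphere of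
  radius \<open>R\<close> to \<open>x\<close>, which avoids \<open>K\<close> and the region where
  the derivative is not yet close to \<Lambda>. The deviation on that sphere is bounded by
  compactness, which is the origin of \<open>C\<close>.\<close>

lemma deviation_bound:
  assumes lim: "(u' \<longlongrightarrow> \<Lambda>) at_infinity" and "0 < e"
  obtains R C where "0 < R" "0 \<le> C" "\<And>x. R \<le> norm x \<Longrightarrow> x \<notin> K"
    "\<And>x. R \<le> norm x \<Longrightarrow> norm (u' x - \<Lambda>) \<le> e"
    "\<And>x. R \<le> norm x \<Longrightarrow> norm (u x - blinfun_apply \<Lambda> x) \<le> C + e * norm x"
proof -
  obtain R1 where R1: "\<And>x. x \<in> K \<Longrightarrow> norm x \<le> R1"
    using compact_imp_bounded[OF K] by (auto simp: bounded_iff)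
  obtain R2 where R2: "\<And>x. R2 \<le> norm x \<Longrightarrow> dist (u' x) \<Lambda> < e"
    using tendstoD[OF lim \<open>0 < e\<close>] by (auto simp: eventually_at_infinity)
  \<comment> \<open>\<open>R1 + 1\<close> keeps the sphere of radius \<open>R\<close> itself off
    \<open>K\<close>; the 1 makes \<open>R\<close> positive, so that radial projection onto the
    sphere makes sense.\<close>
  define R where "R = max 1 (max (R1 + 1) R2)"
  have R: "0 < R" "\<And>x. R \<le> norm x \<Longrightarrow> x \<notin> K" "\<And>x. R \<le> norm x \<Longrightarrow> norm (u' x - \<Lambda>) \<le> e"
    using R1 R2 by (force simp: R_def dist_norm intro: less_imp_le)+
  let ?w = "\<lambda>x. u x - blinfun_apply \<Lambda> x"
  have "compact (?w ` sphere 0 R)"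
    using R(2) by (intro compact_continuous_image continuous_intros continuous_on_subset[OF u_cont]) auto
  then obtain C where C: "\<And>x. norm x = R \<Longrightarrow> norm (?w x) \<le> C"
    using compact_imp_bounded by (fastforce simp: bounded_iff)
  have "norm (?w x) \<le> max C 0 + e * norm x" if x: "R \<le> norm x" for x
  proof -
    \<comment> \<open>\<open>c *\<^sub>R x\<close> is the radial projection of \<open>x\<close> to
      the sphere of radius \<open>R\<close>.\<close>
    define c where "c = R / norm x"
    have "0 < norm x" using x R(1) by linarith
    then have c: "0 < c" "c \<le> 1" "norm (c *\<^sub>R x) = R" using x R(1) by (simp_all add: c_def)
    have seg: "R \<le> norm z" if z: "z \<in> closed_segment (c *\<^sub>R x) x" for z
    proof -
      obtain t where t: "0 \<le> t" "t \<le> 1" "z = (1 - t) *\<^sub>R (c *\<^sub>R x) + t *\<^sub>R x"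
        using z by (auto simp: closed_segment_def)
      then have "z = ((1 - t) * c + t * 1) *\<^sub>R x" by (simp add: scaleR_add_left)
      moreover have "(1 - t) * c + t * c \<le> (1 - t) * c + t * 1" using t c by (intro add_left_mono mult_left_mono) auto
      then have "c \<le> (1 - t) * c + t * 1" by (simp add: algebra_simps)
      ultimately show ?thesis
        using c mult_right_mono[of c "(1 - t) * c + t * 1" "norm x"] by (auto simp: abs_if)
    qed
    have "norm (?w x - ?w (c *\<^sub>R x)) \<le> e * norm (x - c *\<^sub>R x)"
      by (rule linear_part_diff_le[of "closed_segment (c *\<^sub>R x) x"]) (use seg R in auto)
    also have "x - c *\<^sub>R x = (1 - c) *\<^sub>R x" by (simp add: algebra_simps)
    also have "e * norm ((1 - c) *\<^sub>R x) \<le> e * norm x"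
      using c \<open>0 < e\<close> by (intro mult_left_mono) (auto simp: mult_left_le_one_le)
    finally have "norm (?w x - ?w (c *\<^sub>R x)) \<le> e * norm x" .
    then show ?thesis using C[OF c(3)] norm_triangle_sub[of "?w x" "?w (c *\<^sub>R x)"] by linarith
  qed
  with R show ?thesis by (intro that[of R "max C 0"]) auto
qed

text \<open>The size of the bound is irrelevant: it is a constant that vanishes after division by
  \<open>r ^ n\<close>. Bounded slope makes \<open>G\<close> Lipschitz on balls avoiding
  \<open>K\<close>.\<close>

lemma hausdorff_measure_G_ball:
  obtains C where "0 \<le> C" "hausdorff_measure (real CARD('n)) (G ` (- K \<inter> ball 0 R)) \<le> ennreal C"
proof -
  obtain M where M: "\<And>x. x \<notin> K \<Longrightarrow> norm (u' x) \<le> M"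
    using bounded_deriv by (auto simp: bounded_iff)
  let ?M = "max M 0"
  have "hausdorff_measure (real DIM(real^'n)) (G ` (- K \<inter> ball 0 R))
      \<le> ennreal ((1 + ?M) ^ DIM(real^'n)) * emeasure lborel (- K \<inter> ball (0::real^'n) R)"
  proof (rule hausdorff_measure_locally_Lipschitz_image)
    fix x :: "real^'n" and r assume sub: "cball x r \<subseteq> - K \<inter> ball 0 R"
    show "(1 + ?M)-lipschitz_on (cball x r) G"
    proof (rule lipschitz_onI)
      fix y z assume yz: "y \<in> cball x r" "z \<in> cball x r"
      \<comment> \<open>With the zero map in place of \<Lambda>, the estimate for
        \<open>u - \<Lambda>\<close> is the Lipschitz bound for \<open>u\<close> itself.\<close>
      have "norm ((u y - blinfun_apply 0 y) - (u z - blinfun_apply 0 z)) \<le> ?M * norm (y - z)"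
        using sub M yz by (intro linear_part_diff_le[of "cball x r"]) (auto simp: le_max_iff_disj)
      then have "norm (y - z, u y - u z) \<le> norm (y - z) + ?M * norm (y - z)"
        using norm_Pair_le[of "y - z" "u y - u z"] by simp
      then show "dist (G y) (G z) \<le> (1 + ?M) * dist y z"
        by (simp add: dist_norm G_def B_pair_diff algebra_simps)
    qed auto
  qed (use open_Compl_K in auto)
  also have "\<dots> \<le> ennreal ((1 + ?M) ^ DIM(real^'n)) * emeasure lborel (ball (0::real^'n) \<bar>R\<bar>)"
    by (intro mult_left_mono emeasure_mono) auto
  also have "\<dots> = ennreal ((1 + ?M) ^ DIM(real^'n) * (unit_ball_vol (real DIM(real^'n)) * \<bar>R\<bar> ^ DIM(real^'n)))"
    by (subst emeasure_ball) (simp_all add: ennreal_mult)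
  finally show ?thesis by (intro that[rotated]) auto
qed

lemma dim_plane: "dim (plane \<Lambda>) = CARD('n)"
proof -
  have "inj (\<lambda>v. B (v, blinfun_apply \<Lambda> v))"
    by (rule injI) (metis AB prod.inject)
  moreover have "linear (\<lambda>v. B (v, blinfun_apply \<Lambda> v))"
    by (rule linearI) (simp_all add: blinfun.add_right blinfun.scaleR_right flip: linear_add[OF linear_B] linear_scale[OF linear_B])
  ultimately have "dim (plane \<Lambda>) = dim (UNIV :: (real^'n) set)"
    unfolding plane_def by (intro dim_image_eq) (auto intro: inj_on_subset)
  then show ?thesis by simp
qed

text \<open>The far part of the graph is parametrised isometrically from the limit plane, up to a map
  with Lipschitz constant \<open>1 + e\<close>.\<close>

lemma hausdorff_measure_G_far:
  assumes "0 < e" "0 \<le> C" and R: "\<And>x. R \<le> norm x \<Longrightarrow> x \<notin> K" "\<And>x. R \<le> norm x \<Longrightarrow> norm (u' x - \<Lambda>) \<le> e"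
      "\<And>x. R \<le> norm x \<Longrightarrow> norm (u x - blinfun_apply \<Lambda> x) \<le> C + e * norm x"
    and "0 < r"
  shows "hausdorff_measure (real CARD('n)) (G ` {x. R < norm x \<and> G x \<in> ball p r})
    \<le> ennreal ((1 + e) ^ CARD('n) * (unit_ball_vol (real CARD('n)) * ((1 + e) * (r + norm p) + C) ^ CARD('n)))"
proof -
  let ?w = "\<lambda>x. u x - blinfun_apply \<Lambda> x"
  let ?\<Omega> = "{x. R < norm x \<and> G x \<in> ball p r}"
  have "dim (UNIV :: (real^'n) set) = dim (plane \<Lambda>)" by (simp add: dim_plane)
  then obtain J :: "real^'n \<Rightarrow> (real^'n) \<times> (real^'k)" where J: "linear J" "range J = plane \<Lambda>" "\<And>y. norm (J y) = norm y"
    by (metis isometry_subspaces[OF subspace_UNIV subspace_plane] UNIV_I)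
  \<comment> \<open>\<open>T y\<close> is the graph parameter of the point \<open>J y\<close> of the
    limit plane. Thus \<open>G (T y)\<close> is the point of the end lying over \<open>J y\<close>,
    and the two differ by the vertical deviation \<open>?w (T y)\<close>.\<close>
  define T where "T y = fst (A (J y))" for y
  have linT: "linear T"
    unfolding T_def using linear_compose[OF linear_compose[OF J(1) linear_A] linear_fst] by (simp add: o_def)
  have JT: "J y = B (T y, blinfun_apply \<Lambda> (T y))" for y
  proof -
    have "J y \<in> plane \<Lambda>" using J(2) by blast
    then obtain v where "J y = B (v, blinfun_apply \<Lambda> v)" unfolding plane_def by blast
    then show ?thesis by (simp add: T_def)
  qed
  have nT: "norm (T y) \<le> norm y" for y
    using J(3)[of y] norm_fst_le[of "T y" "blinfun_apply \<Lambda> (T y)"] by (simp add: JT)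
  have surjT: "\<exists>y. T y = x" for x
  proof -
    have "B (x, blinfun_apply \<Lambda> x) \<in> range J" using J(2) unfolding plane_def by blast
    then obtain y where "B (x, blinfun_apply \<Lambda> x) = J y" by blast
    then have "T y = x" unfolding T_def by (metis AB fst_conv)
    then show ?thesis ..
  qed
  have cT: "continuous_on S T" for S by (rule linear_continuous_on[OF linear_conv_bounded_linear[THEN iffD1, OF linT]])
  have GT: "G (T y) = J y + B (0, ?w (T y))" for y
    by (simp add: JT G_def flip: linear_add[OF linear_B])
  have "open {x. R < norm x}" by (intro open_Collect_less continuous_intros)
  moreover have "continuous_on {x. R < norm x} G"
    unfolding G_def
    by (intro continuous_on_compose2[OF linear_continuous_on[OF bounded_linear_B, of UNIV]] continuous_intros
        continuous_on_subset[OF u_cont]) (use R(1) in auto)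
  ultimately have "open (G -` ball p r \<inter> {x. R < norm x})"
    using continuous_on_open_vimage[of "{x. R < norm x}" G] by (metis open_ball)
  moreover have "G -` ball p r \<inter> {x. R < norm x} = ?\<Omega>" by auto
  ultimately have "open ?\<Omega>" by metis
  then have open_\<Omega>: "open (T -` ?\<Omega>)" by (intro open_vimage cT)
  have "G ` ?\<Omega> = (\<lambda>y. G (T y)) ` (T -` ?\<Omega>)"
    using surjT by (auto simp: image_iff) metis
  moreover have "hausdorff_measure (real DIM(real^'n)) ((\<lambda>y. G (T y)) ` (T -` ?\<Omega>))
      \<le> ennreal ((1 + e) ^ DIM(real^'n)) * emeasure lborel (T -` ?\<Omega>)"
  proof (rule hausdorff_measure_locally_Lipschitz_image[OF open_\<Omega>])
    fix x r' assume sub: "cball x r' \<subseteq> T -` ?\<Omega>"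
    show "(1 + e)-lipschitz_on (cball x r') (\<lambda>y. G (T y))"
    proof (rule lipschitz_onI)
      fix y z assume yz: "y \<in> cball x r'" "z \<in> cball x r'"
      \<comment> \<open>The linear image of the ball is convex and stays in the region where the
        derivative is close to \<Lambda>, so the mean value inequality applies there.\<close>
      have far: "R < norm t" if "t \<in> T ` cball x r'" for t using that sub by auto
      have "norm (?w (T y) - ?w (T z)) \<le> e * norm (T y - T z)"
        using yz far R(1,2)
        by (intro linear_part_diff_le[of "T ` cball x r'"] convex_linear_image linT) (auto intro: less_imp_le)
      also have "\<dots> \<le> e * norm (y - z)"
        using nT[of "y - z"] \<open>0 < e\<close> by (simp add: linear_diff[OF linT])
      finally have "norm (B (0, ?w (T y)) - B (0, ?w (T z))) \<le> e * norm (y - z)"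
        by (simp add: B_pair_diff norm_Pair)
      moreover have "G (T y) - G (T z) = J (y - z) + (B (0, ?w (T y)) - B (0, ?w (T z)))"
        by (simp add: GT linear_diff[OF J(1)])
      moreover have "norm (J (y - z)) = norm (y - z)" by (rule J(3))
      ultimately have "norm (G (T y) - G (T z)) \<le> norm (y - z) + e * norm (y - z)"
        by (metis add_mono norm_triangle_le order_refl)
      then show "dist (G (T y)) (G (T z)) \<le> (1 + e) * dist y z"
        by (simp add: dist_norm algebra_simps)
    qed (use \<open>0 < e\<close> in simp)
  qed (use \<open>0 < e\<close> in simp)
  \<comment> \<open>The parameter \<open>y\<close> is as long as \<open>J y\<close>. That length is
    at most \<open>norm (G (T y)) \<le> r + norm p\<close> plus the deviation, which is at most
    \<open>C + e * (r + norm p)\<close>; this sum is the radius used here.\<close>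
  moreover have "emeasure lborel (T -` ?\<Omega>) \<le> emeasure lborel (cball (0::real^'n) ((1 + e) * (r + norm p) + C))"
  proof (rule emeasure_mono)
    show "T -` ?\<Omega> \<subseteq> cball 0 ((1 + e) * (r + norm p) + C)"
    proof
      fix y assume y: "y \<in> T -` ?\<Omega>"
      have Gp: "norm (G (T y)) \<le> r + norm p"
        using y norm_triangle_sub[of "G (T y)" p] by (simp add: dist_norm norm_minus_commute)
      have "norm y = norm (G (T y) - B (0, ?w (T y)))" by (simp add: GT J(3))
      also have "\<dots> \<le> norm (G (T y)) + norm (B (0, ?w (T y)))" by (rule norm_triangle_ineq4)
      also have "norm (B (0, ?w (T y))) \<le> C + e * norm (T y)" using R(3)[of "T y"] y by (simp add: norm_Pair)
      also have "e * norm (T y) \<le> e * (r + norm p)"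
        using order_trans[OF norm_G Gp] \<open>0 < e\<close> by (intro mult_left_mono) auto
      finally show "y \<in> cball 0 ((1 + e) * (r + norm p) + C)" using Gp by (simp add: algebra_simps)
    qed
  qed simp
  then have "ennreal ((1 + e) ^ DIM(real^'n)) * emeasure lborel (T -` ?\<Omega>)
      \<le> ennreal ((1 + e) ^ DIM(real^'n)) * emeasure lborel (cball (0::real^'n) ((1 + e) * (r + norm p) + C))"
    by (rule mult_left_mono) simp
  moreover have "0 \<le> (1 + e) * (r + norm p) + C" using assms by simp
  ultimately show ?thesis
    using \<open>0 < e\<close> by (simp add: emeasure_cball ennreal_mult)
qed

text \<open>Monotonicity bounds the ratio at \<open>s\<close> by its limit at infinity. Of the
  factors \<open>1 + e\<close> in that limit, one set comes from the Lipschitz constant of the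
  parametrisation and the other from the enlarged radius; both disappear as \<open>e\<close> tends
  to 0.\<close>

lemma density_ratio_le_one:
  assumes lim: "(u' \<longlongrightarrow> \<Lambda>) at_infinity"
    and finite: "\<And>r. 0 < r \<Longrightarrow> density_ratio CARD('n) X p r < \<infinity>"
    and mono: "mono_on {0<..} (density_ratio CARD('n) X p)" and "0 < s"
  shows "density_ratio CARD('n) X p s \<le> 1"
proof -
  let ?n = "CARD('n)" and ?H = "hausdorff_measure (real CARD('n))" and ?b = "unit_ball_vol (real CARD('n))"
  have b: "0 < ?b" by simp
  have H_finite: "?H (X \<inter> ball p r) < top" if "0 < r" for r
  proof -
    have "?H (X \<inter> ball p r) \<noteq> top"
    proof
      assume "?H (X \<inter> ball p r) = top"
      then have "density_ratio ?n X p r = top"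
        by (simp add: density_ratio_def ennreal_top_divide)
      with finite[OF that] show False by simp
    qed
    then show ?thesis by (simp add: less_top)
  qed
  have bound: "density_ratio ?n X p s \<le> ennreal ((1 + e) ^ ?n * (1 + e) ^ ?n)" if "0 < e" for e
  proof -
    obtain R C where R: "0 < R" "0 \<le> C" "\<And>x. R \<le> norm x \<Longrightarrow> x \<notin> K"
        "\<And>x. R \<le> norm x \<Longrightarrow> norm (u' x - \<Lambda>) \<le> e"
        "\<And>x. R \<le> norm x \<Longrightarrow> norm (u x - blinfun_apply \<Lambda> x) \<le> C + e * norm x"
      using deviation_bound[OF lim \<open>0 < e\<close>] by blast
    \<comment> \<open>The radius is \<open>R + 1\<close> because the open ball must contain all
      parameters of norm at most \<open>R\<close>.\<close>
    obtain C1 where C1: "0 \<le> C1" "?H (G ` (- K \<inter> ball 0 (R + 1))) \<le> ennreal C1"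
      by (rule hausdorff_measure_G_ball)
    obtain R' where R': "0 < R'" "K' \<subseteq> ball p R'"
      using bounded_subset_ballD[OF compact_imp_bounded[OF K']] by blast
    obtain C2 where C2: "0 \<le> C2" "?H (X \<inter> ball p R') = ennreal C2"
      using H_finite[OF R'(1)] by (cases "?H (X \<inter> ball p R')") auto
    let ?D = "(1 + e) * norm p + C"
    let ?h = "\<lambda>r. (C1 + C2) / ?b * (1 / r) ^ ?n + (1 + e) ^ ?n * ((1 + e) + ?D * (1 / r)) ^ ?n"
    have ratio: "density_ratio ?n X p s \<le> ennreal (?h r)" if r: "s \<le> r" for r
    proof -
      have "0 < r" using r \<open>0 < s\<close> by simp
      let ?F = "{x. R < norm x \<and> G x \<in> ball p r}"
      have "X \<inter> ball p r \<subseteq> (X \<inter> ball p R') \<union> (G ` (- K \<inter> ball 0 (R + 1)) \<union> G ` ?F)"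
      proof
        fix z assume z: "z \<in> X \<inter> ball p r"
        show "z \<in> (X \<inter> ball p R') \<union> (G ` (- K \<inter> ball 0 (R + 1)) \<union> G ` ?F)"
        proof (cases "z \<in> K'")
          case True
          then show ?thesis using R'(2) z by auto
        next
          case False
          then have "z \<in> G ` (- K)" using z end_eq by auto
          then obtain x where "x \<notin> K" "z = G x" by auto
          then show ?thesis using z by (cases "R < norm x") auto
        qed
      qed
      then have "?H (X \<inter> ball p r) \<le> ?H ((X \<inter> ball p R') \<union> (G ` (- K \<inter> ball 0 (R + 1)) \<union> G ` ?F))"
        by (rule hausdorff_measure_mono)
      also have "\<dots> \<le> ?H (X \<inter> ball p R') + (?H (G ` (- K \<inter> ball 0 (R + 1))) + ?H (G ` ?F))"
        by (intro order_trans[OF hausdorff_measure_Un_le] add_left_mono hausdorff_measure_Un_le)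
      also have "\<dots> \<le> ennreal C2 + (ennreal C1 + ennreal ((1 + e) ^ ?n * (?b * ((1 + e) * (r + norm p) + C) ^ ?n)))"
        unfolding C2(2)
        by (intro add_left_mono add_mono C1 hausdorff_measure_G_far[where \<Lambda>=\<Lambda>] \<open>0 < e\<close> R(2) R(3-5) \<open>0 < r\<close>)
      also have "\<dots> = ennreal (C2 + (C1 + (1 + e) ^ ?n * (?b * ((1 + e) * (r + norm p) + C) ^ ?n)))"
        using C1 C2 R \<open>0 < e\<close> \<open>0 < r\<close> b by (simp add: ennreal_plus)
      finally have "density_ratio ?n X p r
          \<le> ennreal (C2 + (C1 + (1 + e) ^ ?n * (?b * ((1 + e) * (r + norm p) + C) ^ ?n))) / ennreal (?b * r ^ ?n)"
        unfolding density_ratio_def by (rule divide_right_mono_ennreal)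
      also have "\<dots> = ennreal ((C2 + (C1 + (1 + e) ^ ?n * (?b * ((1 + e) * (r + norm p) + C) ^ ?n))) / (?b * r ^ ?n))"
        using C1 C2 R \<open>0 < e\<close> \<open>0 < r\<close> b by (intro divide_ennreal) auto
      also have "(C2 + (C1 + (1 + e) ^ ?n * (?b * ((1 + e) * (r + norm p) + C) ^ ?n))) / (?b * r ^ ?n) = ?h r"
      proof -
        have "((1 + e) + ?D * (1 / r)) ^ ?n = ((1 + e) * (r + norm p) + C) ^ ?n / r ^ ?n"
          unfolding power_divide[symmetric] using \<open>0 < r\<close> by (simp add: field_simps)
        moreover have "(C2 + (C1 + P * (b * Q))) / (b * q) = (C1 + C2) / b * (1 / q) + P * (Q / q)"
          if "0 < b" "0 < q" for P b Q q :: real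
          using that by (simp add: field_simps)
        ultimately show ?thesis
          using \<open>0 < r\<close> b by (simp add: power_one_over)
      qed
      finally have "density_ratio ?n X p r \<le> ennreal (?h r)" .
      moreover have "density_ratio ?n X p s \<le> density_ratio ?n X p r"
        using mono r \<open>0 < s\<close> by (auto simp: mono_on_def)
      ultimately show ?thesis by (rule order_trans[rotated])
    qed
    have "((\<lambda>r. 1 / r) \<longlongrightarrow> (0::real)) at_top"
      using tendsto_inverse_0_at_top[OF filterlim_ident] by (simp add: inverse_eq_divide)
    then have "(?h \<longlongrightarrow> (C1 + C2) / ?b * 0 ^ ?n + (1 + e) ^ ?n * ((1 + e) + ?D * 0) ^ ?n) at_top"
      by (intro tendsto_intros)
    \<comment> \<open>The first summand disappears because \<open>CARD('n)\<close> is positive, so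
      that \<open>0 ^ ?n = 0\<close>.\<close>
    then have "((\<lambda>r. ennreal (?h r)) \<longlongrightarrow> ennreal ((1 + e) ^ ?n * (1 + e) ^ ?n)) at_top"
      by (intro tendsto_ennrealI) (simp add: power_0_left)
    moreover have "\<forall>\<^sub>F r in at_top. density_ratio ?n X p s \<le> ennreal (?h r)"
      using eventually_ge_at_top[of s] by eventually_elim (rule ratio)
    ultimately show ?thesis by (rule tendsto_lowerbound) simp
  qed
  have "((\<lambda>e. (1 + e) ^ ?n * (1 + e) ^ ?n) \<longlongrightarrow> (1 + 0) ^ ?n * (1 + 0) ^ ?n) (at_right (0::real))"
    by (intro tendsto_intros)
  then have "((\<lambda>e. ennreal ((1 + e) ^ ?n * (1 + e) ^ ?n)) \<longlongrightarrow> ennreal 1) (at_right 0)"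
    by (intro tendsto_ennrealI) simp
  moreover have "\<forall>\<^sub>F e in at_right 0. density_ratio ?n X p s \<le> ennreal ((1 + e) ^ ?n * (1 + e) ^ ?n)"
    using eventually_at_right_less[of "0::real"] by eventually_elim (rule bound)
  ultimately have "density_ratio ?n X p s \<le> ennreal 1" by (rule tendsto_lowerbound) simp
  then show ?thesis by simp
qed

section \<open>Closed cones asymptotic to a plane\<close>

lemma deviation_tendsto_0:
  assumes lim: "(u' \<longlongrightarrow> \<Lambda>) at_infinity" and "a \<noteq> 0"
  shows "((\<lambda>t. (1 / t) *\<^sub>R (u (b + t *\<^sub>R a) - blinfun_apply \<Lambda> (b + t *\<^sub>R a))) \<longlongrightarrow> 0) at_top"
proof (rule tendstoI)
  fix \<epsilon> :: real assume "0 < \<epsilon>"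
  \<comment> \<open>Division by \<open>t\<close> removes the additive constant of the deviation
    bound and leaves \<open>e * norm a\<close> in the limit, which has to be below
    \<epsilon>.\<close>
  define e where "e = \<epsilon> / (2 * (norm a + 1))"
  have "0 < norm a" using \<open>a \<noteq> 0\<close> by simp
  then have e: "0 < e" "e * norm a < \<epsilon>"
    using \<open>0 < \<epsilon>\<close> mult_pos_pos[OF \<open>0 < \<epsilon>\<close> \<open>0 < norm a\<close>]
    by (simp_all add: e_def add_pos_pos divide_less_eq algebra_simps)
  obtain R C where R: "0 \<le> C" "\<And>x. R \<le> norm x \<Longrightarrow> norm (u x - blinfun_apply \<Lambda> x) \<le> C + e * norm x"
    using deviation_bound[OF lim e(1)] by metis
  have "filterlim (\<lambda>t. - norm b + norm a * t) at_top at_top"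
    using \<open>0 < norm a\<close> by (intro filterlim_tendsto_add_at_top[OF tendsto_const]
      filterlim_tendsto_pos_mult_at_top[OF tendsto_const] filterlim_ident) auto
  then have "\<forall>\<^sub>F t in at_top. R \<le> - norm b + norm a * t" by (simp add: filterlim_at_top)
  moreover have "((\<lambda>t. (C + e * norm b) * (1 / t) + e * norm a) \<longlongrightarrow> (C + e * norm b) * 0 + e * norm a) at_top"
    using tendsto_inverse_0_at_top[OF filterlim_ident] by (intro tendsto_intros) (simp add: inverse_eq_divide)
  then have "\<forall>\<^sub>F t in at_top. (C + e * norm b) * (1 / t) + e * norm a < \<epsilon>"
    by (rule order_tendstoD) (use e in simp)
  ultimately show "\<forall>\<^sub>F t in at_top. dist ((1 / t) *\<^sub>R (u (b + t *\<^sub>R a) - blinfun_apply \<Lambda> (b + t *\<^sub>R a))) 0 < \<epsilon>"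
    using eventually_gt_at_top[of 0]
  proof eventually_elim
    case (elim t)
    let ?x = "b + t *\<^sub>R a"
    have "R \<le> norm ?x" using elim norm_diff_ineq[of "t *\<^sub>R a" b] by (simp add: add.commute mult.commute)
    then have "norm (u ?x - blinfun_apply \<Lambda> ?x) \<le> C + e * norm ?x" by (rule R)
    also have "e * norm ?x \<le> e * (norm b + t * norm a)"
      using norm_triangle_ineq[of b "t *\<^sub>R a"] elim e by (intro mult_left_mono) auto
    finally have "(1 / t) * norm (u ?x - blinfun_apply \<Lambda> ?x) \<le> (1 / t) * (C + e * (norm b + t * norm a))"
      using elim by (intro mult_left_mono) auto
    also have "\<dots> = (C + e * norm b) * (1 / t) + e * norm a" using elim by (simp add: field_simps)
    finally show ?case using elim by simp
  qed
qed

text \<open>A ray of the cone eventually runs inside the graph, and dividing by its parameter shows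
  that its direction lies in \<open>plane \<Lambda>\<close>. Conversely, far graph points over a ray
  of parameters, shrunk towards \<open>p\<close>, stay in the cone and converge to any prescribed
  point of the plane; closedness keeps the limit in \<open>X\<close>.\<close>

theorem cone_eq_translate_plane:
  assumes lim: "(u' \<longlongrightarrow> \<Lambda>) at_infinity"
    and "closed X" "p \<in> X" and cone: "cone_with_vertex p X"
  shows "X = (+) p ` plane \<Lambda>"
proof
  have ray: "p + t *\<^sub>R v \<in> X" if "p + v \<in> X" "0 \<le> t" for t v
  proof -
    have "v \<in> (\<lambda>x. x - p) ` X" using that(1) by (intro image_eqI[of _ _ "p + v"]) auto
    then have "t *\<^sub>R v \<in> (\<lambda>x. x - p) ` X" using cone that(2) unfolding cone_with_vertex_def cone_def by blast
    then show ?thesis by auto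
  qed
  show "X \<subseteq> (+) p ` plane \<Lambda>"
  proof
    fix x assume "x \<in> X"
    define v where "v = x - p"
    define v1 v2 p1 p2 where "v1 = fst (A v)" "v2 = snd (A v)" "p1 = fst (A p)" "p2 = snd (A p)"
    have pv: "p + v \<in> X" using \<open>x \<in> X\<close> by (simp add: v_def)
    have Apv: "A (p + t *\<^sub>R v) = (p1 + t *\<^sub>R v1, p2 + t *\<^sub>R v2)" for t
      by (simp add: v1_v2_p1_p2_def linear_add[OF linear_A] linear_scale[OF linear_A] prod_eq_iff)
    have v_eq: "v = B (v1, v2)" by (simp add: v1_v2_p1_p2_def)
    have "v \<in> plane \<Lambda>"
    proof (cases "v = 0")
      case True
      then show ?thesis using subspace_0[OF subspace_plane] by simp
    next
      case False
      obtain R where R: "\<And>z. z \<in> K' \<Longrightarrow> norm z \<le> R"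
        using compact_imp_bounded[OF K'] by (auto simp: bounded_iff)
      have "filterlim (\<lambda>t. - norm p + norm v * t) at_top at_top"
        using False by (intro filterlim_tendsto_add_at_top[OF tendsto_const]
          filterlim_tendsto_pos_mult_at_top[OF tendsto_const] filterlim_ident) auto
      then have "\<forall>\<^sub>F t in at_top. R < - norm p + norm v * t" by (simp add: filterlim_at_top_dense)
      then have graph_ev: "\<forall>\<^sub>F t in at_top. p2 + t *\<^sub>R v2 = u (p1 + t *\<^sub>R v1)"
        using eventually_ge_at_top[of 0]
      proof eventually_elim
        case (elim t)
        have "R < norm (p + t *\<^sub>R v)" using elim norm_diff_ineq[of "t *\<^sub>R v" p] by (simp add: add.commute mult.commute)
        then have "p + t *\<^sub>R v \<in> X - K'" using ray[OF pv elim(2)] R by (metis Diff_iff not_le)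
        then obtain y where "p + t *\<^sub>R v = G y" unfolding end_eq by auto
        then have "A (p + t *\<^sub>R v) = (y, u y)" by (simp add: G_def)
        then show ?case by (simp add: Apv)
      qed
      \<comment> \<open>A vertical ray would stay over the single parameter \<open>p1\<close>, where
        the graph has only one point.\<close>
      have "v1 \<noteq> 0"
      proof
        assume "v1 = 0"
        obtain t0 where t0: "\<And>t. t0 \<le> t \<Longrightarrow> p2 + t *\<^sub>R v2 = u p1"
          using graph_ev \<open>v1 = 0\<close> by (auto simp: eventually_at_top_linorder)
        have "p2 + t0 *\<^sub>R v2 = p2 + (t0 + 1) *\<^sub>R v2" using t0[of t0] t0[of "t0 + 1"] by simp
        then have "v2 = 0" by (simp add: algebra_simps)
        with \<open>v1 = 0\<close> False v_eq show False by (simp flip: zero_prod_def)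
      qed
      let ?d = "v2 - blinfun_apply \<Lambda> v1"
      have "((\<lambda>t. (1 / t) *\<^sub>R (u (p1 + t *\<^sub>R v1) - blinfun_apply \<Lambda> (p1 + t *\<^sub>R v1))) \<longlongrightarrow> 0) at_top"
        by (rule deviation_tendsto_0[OF lim \<open>v1 \<noteq> 0\<close>])
      moreover have "\<forall>\<^sub>F t in at_top. (1 / t) *\<^sub>R (u (p1 + t *\<^sub>R v1) - blinfun_apply \<Lambda> (p1 + t *\<^sub>R v1))
          = (1 / t) *\<^sub>R (p2 - blinfun_apply \<Lambda> p1) + ?d"
        using graph_ev eventually_gt_at_top[of 0]
      proof eventually_elim
        case (elim t)
        have "u (p1 + t *\<^sub>R v1) - blinfun_apply \<Lambda> (p1 + t *\<^sub>R v1) = (p2 - blinfun_apply \<Lambda> p1) + t *\<^sub>R ?d"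
          using elim(1) by (simp add: blinfun.add_right blinfun.scaleR_right algebra_simps)
        then show ?case using elim(2) by (simp add: scaleR_add_right)
      qed
      ultimately have "((\<lambda>t. (1 / t) *\<^sub>R (p2 - blinfun_apply \<Lambda> p1) + ?d) \<longlongrightarrow> 0) at_top"
        by (rule Lim_transform_eventually)
      moreover have "((\<lambda>t. (1 / t) *\<^sub>R (p2 - blinfun_apply \<Lambda> p1) + ?d) \<longlongrightarrow> 0 *\<^sub>R (p2 - blinfun_apply \<Lambda> p1) + ?d) at_top"
        using tendsto_inverse_0_at_top[OF filterlim_ident] by (intro tendsto_intros) (simp add: inverse_eq_divide)
      ultimately have "?d = 0" using tendsto_unique[OF trivial_limit_at_top_linorder] by fastforce
      then show ?thesis unfolding plane_def v_eq by simp
    qed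
    then show "x \<in> (+) p ` plane \<Lambda>" by (intro image_eqI[of _ _ v]) (simp add: v_def)
  qed
  show "(+) p ` plane \<Lambda> \<subseteq> X"
  proof
    fix z assume "z \<in> (+) p ` plane \<Lambda>"
    then obtain a where z: "z = p + B (a, blinfun_apply \<Lambda> a)" unfolding plane_def by auto
    show "z \<in> X"
    proof (cases "a = 0")
      case True
      then show ?thesis using z \<open>p \<in> X\<close> by (simp flip: zero_prod_def)
    next
      case False
      obtain R where R: "\<And>x. x \<in> K \<Longrightarrow> norm x \<le> R"
        using compact_imp_bounded[OF K] by (auto simp: bounded_iff)
      let ?w = "\<lambda>t. (1 / t) *\<^sub>R (u (0 + t *\<^sub>R a) - blinfun_apply \<Lambda> (0 + t *\<^sub>R a))"
      \<comment> \<open>This is \<open>p + (1 / t) *\<^sub>R (G (t *\<^sub>R a) - p)\<close>, the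
        far graph point shrunk towards the vertex, rearranged so that its limit can be read
        off.\<close>
      let ?q = "\<lambda>t. p + (B (a, blinfun_apply \<Lambda> a) + B (0, ?w t) - (1 / t) *\<^sub>R p)"
      have "(?w \<longlongrightarrow> 0) at_top" by (rule deviation_tendsto_0[OF lim False])
      then have "((\<lambda>t. B (0, ?w t)) \<longlongrightarrow> B (0, 0)) at_top"
        by (intro bounded_linear.tendsto[OF bounded_linear_B] tendsto_intros)
      then have "(?q \<longlongrightarrow> p + (B (a, blinfun_apply \<Lambda> a) + B (0, 0) - 0 *\<^sub>R p)) at_top"
        using tendsto_inverse_0_at_top[OF filterlim_ident] by (intro tendsto_intros) (simp_all add: inverse_eq_divide)
      then have q: "(?q \<longlongrightarrow> z) at_top" by (simp add: z flip: zero_prod_def)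
      have "filterlim (\<lambda>t. norm a * t) at_top at_top"
        using False by (intro filterlim_tendsto_pos_mult_at_top[OF tendsto_const] filterlim_ident) auto
      then have "\<forall>\<^sub>F t in at_top. R < norm a * t" by (simp add: filterlim_at_top_dense)
      then have "\<forall>\<^sub>F t in at_top. ?q t \<in> X"
        using eventually_gt_at_top[of 0]
      proof eventually_elim
        case (elim t)
        then have "t *\<^sub>R a \<notin> K" using R[of "t *\<^sub>R a"] by (auto simp: mult.commute)
        then have "p + (G (t *\<^sub>R a) - p) \<in> X" using end_eq by auto
        then have "p + (1 / t) *\<^sub>R (G (t *\<^sub>R a) - p) \<in> X" by (rule ray) (use elim in simp)
        moreover have "(1 / t) *\<^sub>R G (t *\<^sub>R a) = B (a, blinfun_apply \<Lambda> a) + B (0, ?w t)"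
          using elim
          by (simp add: G_def blinfun.scaleR_right scaleR_diff_right flip: linear_add[OF linear_B] linear_scale[OF linear_B])
        ultimately show ?case by (simp add: scaleR_diff_right)
      qed
      then show ?thesis by (rule Lim_in_closed_set[OF \<open>closed X\<close> _ trivial_limit_at_top_linorder q])
    qed
  qed
qed

end

section \<open>Equivalence of the asymptotic conditions with being an affine plane\<close>

theorem theorem5p1:
  fixes X :: "((real^'n::finite) \<times> (real^'k::finite)) set"
  assumes "connected X" and "closed X" and "hausdorff_dim X = of_nat CARD('n)"
  shows "affine X \<and> aff_dim X = int CARD('n) \<longleftrightarrow>
    (\<exists>p\<in>X. satisfies_monotonicity_formula CARD('n) X p)
    \<and> C1_graph_outside_compact X
    \<and> subspace (tangents_at_infinity X)"
proof
  assume X: "affine X \<and> aff_dim X = int CARD('n)"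
  then have "X \<noteq> {}" by auto
  then obtain p where p: "p \<in> X" by blast
  let ?L = "(\<lambda>x. - p + x) ` X"
  have L: "subspace ?L" using X p by (intro affine_diffs_subspace) auto
  have dim: "dim ?L = CARD('n)"
    using X aff_dim_subspace[OF L] aff_dim_translation_eq[of "- p" X] by simp
  \<comment> \<open>Index types are nonempty, so the dimension is at least 1.\<close>
  then have "?L \<noteq> {0}" by auto
  have X_eq: "X = (+) p ` ?L" by (simp add: image_image)
  show "(\<exists>p\<in>X. satisfies_monotonicity_formula CARD('n) X p) \<and> C1_graph_outside_compact X
    \<and> subspace (tangents_at_infinity X)"
  proof (intro conjI bexI)
    show "satisfies_monotonicity_formula CARD('n) X p"
      by (rule satisfies_monotonicity_formula_translate_subspace[OF L dim X_eq])
    show "C1_graph_outside_compact X"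
      by (subst X_eq) (rule C1_graph_outside_compact_translate_subspace[OF L dim])
    show "subspace (tangents_at_infinity X)"
      by (subst tangents_at_infinity_translate_subspace[OF L \<open>?L \<noteq> {0}\<close> X_eq]) (rule L)
  qed (rule p)
next
  assume asm: "(\<exists>p\<in>X. satisfies_monotonicity_formula CARD('n) X p)
    \<and> C1_graph_outside_compact X \<and> subspace (tangents_at_infinity X)"
  then obtain p where p: "p \<in> X" and mono: "satisfies_monotonicity_formula CARD('n) X p" by blast
  obtain A K K' and u :: "real^'n \<Rightarrow> real^'k" and u' where
      "orthogonal_transformation A" "compact K" "compact K'" "has_C1_derivative_on u u' (- K)"
      "bounded (u' ` (- K))" "A ` (X - K') = {(x, u x) |x. x \<in> - K}"
    using asm unfolding C1_graph_outside_compact_def by blast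
  then interpret C1_graph_end X A K K' u u' by unfold_locales
  obtain \<Lambda> where \<Lambda>: "(u' \<longlongrightarrow> \<Lambda>) at_infinity"
    using asm deriv_tendsto_at_infinity by blast
  \<comment> \<open>The upper bound comes from the asymptotics, the lower bound from the
    monotonicity formula itself.\<close>
  have "density_ratio CARD('n) X p r = 1" if "0 < r" for r
    using mono that unfolding satisfies_monotonicity_formula_def
    by (intro antisym density_ratio_le_one[OF \<Lambda>]) auto
  then have "density_ratio CARD('n) X p constant_on {0<..}" by (auto simp: constant_on_def)
  then have "cone_with_vertex p X" using mono by (simp add: satisfies_monotonicity_formula_def)
  then have X: "X = (+) p ` plane \<Lambda>" by (rule cone_eq_translate_plane[OF \<Lambda> \<open>closed X\<close> p])
  have "affine X" unfolding X by (simp add: affine_translation[symmetric] subspace_imp_affine subspace_plane)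
  moreover have "aff_dim X = int CARD('n)"
    unfolding X by (simp add: aff_dim_translation_eq aff_dim_subspace subspace_plane dim_plane)
  ultimately show "affine X \<and> aff_dim X = int CARD('n)" ..
qed

end
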